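(* Let $(M^3,g)$ be a 3-dimensional connected oriented pseudo-Riemannian manifold and let $\alpha\colon I\to M^3$ ($I$ an open interval) be a non-null, non-degenerate, arc length parametrized curve with $g(\nabla_{\alpha'}\alpha',\nabla_{\alpha'}\alpha')\neq0$ at every point. If the Frenet curvature $\kappa$ and torsion $\tau$ of $\alpha$ are constant, then the equi-affine curvatures $\varkappa_1,\varkappa_2$ of $\alpha$ are also constant and $$\varkappa_1=0,\qquad \varkappa_2=-\frac{\varepsilon_2(\varepsilon_1\kappa^2+\varepsilon_3\tau^2)}{\kappa^{2/3}|\tau|^{1/3}}.$$
   Context: Let $(M^3,g)$ be a connected oriented 3-dimensional pseudo-Riemannian manifold (any signature, including Riemannian), $\nabla$ its Levi-Civita connection, and $\Omega$ its natural volume form compatible with the orientation, i.e. in positively oriented local coordinates $\Omega(\partial_i,\partial_j,\partial_k)=\sqrt{|G|}\,\varepsilon_{ijk}$, with $G=\det[g_{ij}]$ and $\varepsilon_{ijk}$ the Levi-Civita symbol (so $\Omega=1$ on positively oriented orthonormal frames). Put $\omega=\operatorname{sign}G$. The cross product is defined by $g(X\times Y,Z)=\Omega(X,Y,Z)$ for all $Z$. Frenet frame: let $\alpha\colon I\to M^3$ be a smooth non-null curve parametrized by arc length, $g(\alpha',\alpha')=\varepsilon_1\in\{1,-1\}$, with $g(\nabla_{\alpha'}\alpha',\nabla_{\alpha'}\alpha')\neq0$ everywhere. Put $\mathbf T=\alpha'$ and $\varepsilon_2=\operatorname{sign}g(\nabla_{\mathbf T}\mathbf T,\nabla_{\mathbf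 T}\mathbf T)$. The unit principal normal $\mathbf N$ and the positive function $\kappa$ (curvature) are defined by $\nabla_{\mathbf T}\mathbf T=\varepsilon_2\kappa\mathbf N$, $g(\mathbf N,\mathbf N)=\varepsilon_2$. Put $\varepsilon_3=\omega\varepsilon_1\varepsilon_2$ and $\mathbf B=\varepsilon_3\,\mathbf T\times\mathbf N$; then $g(\mathbf B,\mathbf B)=\varepsilon_3$ and $\Omega(\mathbf T,\mathbf N,\mathbf B)=1$. The torsion $\tau$ is the function with $\nabla_{\mathbf T}\mathbf N=-\varepsilon_1\kappa\mathbf T+\varepsilon_3\tau\mathbf B$; also $\nabla_{\mathbf T}\mathbf B=-\varepsilon_2\tau\mathbf N$. Equi-affine objects: $(M^3,\nabla,\Omega)$ is regarded as an equi-affine manifold. With $\nabla^2_{\alpha'}\alpha'=\nabla_{\alpha'}(\nabla_{\alpha'}\alpha')$, the curve $\alpha$ is non-degenerate if $\Omega(\alpha',\nabla_{\alpha'}\alpha',\nabla^2_{\alpha'}\alpha')\neq0$ at every point (here this quantity equals $\varepsilon_3\kappa^2\tau$, so $\tau$ is nowhere zero). Put $\varphi=|\Omega(\alpha',\nabla_{\alpha'}\alpha',\nabla^2_{\alpha'}\alpha')|^{-1/6}$. The Cartan frame is $\mathbf e_1=\varphi\alpha'$, $\mathbf e_2=\nabla_{\mathbf e_1}\mathbf e_1$, $\mathbf e_3=\nabla_{\mathbf e_1}\mathbf e_2$, where $\nabla_{\mathbf e_1}=\varphi\nabla_{\alpha'}$. The equi-affine curvatures $\varkappa_1,\varkappa_2$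 are the unique functions on $I$ with $\nabla_{\mathbf e_1}\mathbf e_3=\varkappa_1\mathbf e_1+\varkappa_2\mathbf e_2$. *)

theory Defs
  imports "HOL-Analysis.Analysis"
begin

section \<open>Smooth maps on open sets\<close>

text \<open>Both predicates are meant for open \<open>S\<close> in a finite-dimensional space, where having all
  directional derivatives of class \<open>C\<^sup>k\<close> is the same as the derivative being of class \<open>C\<^sup>k\<close>.\<close>

fun Ck_on :: "nat \<Rightarrow> 'a::euclidean_space set \<Rightarrow> ('a \<Rightarrow> 'b::real_normed_vector) \<Rightarrow> bool" where
  "Ck_on 0 S f \<longleftrightarrow> continuous_on S f"
| "Ck_on (Suc k) S f \<longleftrightarrow>
     (\<forall>x\<in>S. f differentiable (at x)) \<and> (\<forall>v. Ck_on k S (\<lambda>x. frechet_derivative f (at x) v))"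

definition smooth_on :: "'a::euclidean_space set \<Rightarrow> ('a \<Rightarrow> 'b::real_normed_vector) \<Rightarrow> bool" where
  "smooth_on S f \<longleftrightarrow> (\<forall>k. Ck_on k S f)"


section \<open>Oriented smooth 3-manifolds\<close>

text \<open>The manifold is the whole type \<open>'m\<close> (Hausdorff and second countable by its type class).
  A chart is a pair of its domain and its coordinate map; values of the coordinate map outside
  the domain are irrelevant.\<close>

type_synonym 'm chart = "'m set \<times> ('m \<Rightarrow> real^3)"

abbreviation cdom :: "'m chart \<Rightarrow> 'm set" where "cdom c \<equiv> fst c"
abbreviation coord :: "'m chart \<Rightarrow> 'm \<Rightarrow> real^3" where "coord c \<equiv> snd c"

definition cinv :: "'m chart \<Rightarrow> real^3 \<Rightarrow> 'm" where
  "cinv c = inv_into (cdom c) (coord c)"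

definition is_chart :: "'m::topological_space chart \<Rightarrow> bool" where
  "is_chart c \<longleftrightarrow> open (cdom c) \<and> open (coord c ` cdom c) \<and>
     homeomorphism (cdom c) (coord c ` cdom c) (coord c) (cinv c)"

definition transition :: "'m chart \<Rightarrow> 'm chart \<Rightarrow> real^3 \<Rightarrow> real^3" where
  "transition c d = coord d \<circ> cinv c"

definition jac :: "'m chart \<Rightarrow> 'm chart \<Rightarrow> 'm \<Rightarrow> real^3 \<Rightarrow> real^3" where
  "jac c d p = frechet_derivative (transition c d) (at (coord c p))"

text \<open>An orientation is given by an atlas of positively oriented charts (not required to be
  maximal).\<close>

definition oriented_atlas :: "'m::{t2_space,second_countable_topology} chart set \<Rightarrow> bool" where
  "oriented_atlas A \<longleftrightarrow>
     (\<forall>c\<in>A. is_chart c) \<and> (\<Union>c\<in>A. cdom c) = UNIV \<and>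
     (\<forall>c\<in>A. \<forall>d\<in>A. smooth_on (coord c ` (cdom c \<inter> cdom d)) (transition c d) \<and>
        (\<forall>p\<in>cdom c \<inter> cdom d. 0 < det (matrix (jac c d p))))"

definition chart_at :: "'m chart set \<Rightarrow> 'm \<Rightarrow> 'm chart" where
  "chart_at A p = (SOME c. c \<in> A \<and> p \<in> cdom c)"


section \<open>Tangent vectors and vector fields\<close>

text \<open>A tangent vector at \<open>p\<close> assigns to each chart around \<open>p\<close> a component vector, and the
  components in different charts are related by the derivative of the change of coordinates.
  The value \<open>0\<close> at all other charts makes tangent vectors extensional.\<close>

type_synonym 'm tvec = "'m chart \<Rightarrow> real^3"

definition tadd :: "'m tvec \<Rightarrow> 'm tvec \<Rightarrow> 'm tvec" (infixl "\<oplus>" 65) where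
  "v \<oplus> w = (\<lambda>c. v c + w c)"

definition tscale :: "real \<Rightarrow> 'm tvec \<Rightarrow> 'm tvec" (infixr "\<odot>" 75) where
  "a \<odot> v = (\<lambda>c. a *\<^sub>R v c)"

definition tzero :: "'m tvec" where
  "tzero = (\<lambda>c. 0)"

definition tangent_space :: "'m chart set \<Rightarrow> 'm \<Rightarrow> 'm tvec set" where
  "tangent_space A p =
     {v. (\<forall>c. c \<notin> A \<or> p \<notin> cdom c \<longrightarrow> v c = 0) \<and>
         (\<forall>c\<in>A. \<forall>d\<in>A. p \<in> cdom c \<inter> cdom d \<longrightarrow> v d = jac c d p (v c))}"

definition coord_field :: "'m chart set \<Rightarrow> 'm chart \<Rightarrow> 3 \<Rightarrow> 'm \<Rightarrow> 'm tvec" where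
  "coord_field A c i p =
     (\<lambda>d. if c \<in> A \<and> d \<in> A \<and> p \<in> cdom c \<inter> cdom d then jac c d p (axis i 1) else 0)"

definition smooth_fun_on :: "'m::topological_space chart set \<Rightarrow> 'm set \<Rightarrow> ('m \<Rightarrow> real) \<Rightarrow> bool" where
  "smooth_fun_on A U f \<longleftrightarrow>
     open U \<and> (\<forall>c\<in>A. smooth_on (coord c ` (cdom c \<inter> U)) (\<lambda>x. f (cinv c x)))"

definition smooth_field_on ::
    "'m::topological_space chart set \<Rightarrow> 'm set \<Rightarrow> ('m \<Rightarrow> 'm tvec) \<Rightarrow> bool" where
  "smooth_field_on A U Y \<longleftrightarrow>
     open U \<and> (\<forall>p\<in>U. Y p \<in> tangent_space A p) \<and>
     (\<forall>c\<in>A. smooth_on (coord c ` (cdom c \<inter> U)) (\<lambda>x. Y (cinv c x) c))"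

text \<open>The derivative of \<open>f\<close> in the direction of the tangent vector \<open>v\<close> at \<open>p\<close>; by the chain rule
  it does not depend on the chart.\<close>

definition dir_deriv :: "'m chart set \<Rightarrow> 'm \<Rightarrow> 'm tvec \<Rightarrow> ('m \<Rightarrow> real) \<Rightarrow> real" where
  "dir_deriv A p v f =
     (let c = chart_at A p in frechet_derivative (\<lambda>x. f (cinv c x)) (at (coord c p)) (v c))"

definition lie_bracket ::
    "'m chart set \<Rightarrow> ('m \<Rightarrow> 'm tvec) \<Rightarrow> ('m \<Rightarrow> 'm tvec) \<Rightarrow> 'm \<Rightarrow> 'm tvec" where
  "lie_bracket A X Y p =
     (\<lambda>c. if c \<in> A \<and> p \<in> cdom c then
        frechet_derivative (\<lambda>x. Y (cinv c x) c) (at (coord c p)) (X p c) -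
        frechet_derivative (\<lambda>x. X (cinv c x) c) (at (coord c p)) (Y p c)
      else 0)"


section \<open>Pseudo-Riemannian metric, volume form, cross product\<close>

type_synonym 'm metric = "'m \<Rightarrow> 'm tvec \<Rightarrow> 'm tvec \<Rightarrow> real"

definition gram :: "'m chart set \<Rightarrow> 'm metric \<Rightarrow> 'm chart \<Rightarrow> 'm \<Rightarrow> real^3^3" where
  "gram A g c p = (\<chi> i j. g p (coord_field A c i p) (coord_field A c j p))"

definition pseudo_riemannian_metric :: "'m chart set \<Rightarrow> 'm metric \<Rightarrow> bool" where
  "pseudo_riemannian_metric A g \<longleftrightarrow>
     (\<forall>p. \<forall>u\<in>tangent_space A p. \<forall>v\<in>tangent_space A p. \<forall>w\<in>tangent_space A p. \<forall>a b.
        g p (a \<odot> u \<oplus> b \<odot> v) w = a * g p u w + b * g p v w) \<and>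
     (\<forall>p. \<forall>u\<in>tangent_space A p. \<forall>v\<in>tangent_space A p. g p u v = g p v u) \<and>
     (\<forall>p. \<forall>u\<in>tangent_space A p. (\<forall>w\<in>tangent_space A p. g p u w = 0) \<longrightarrow> u = tzero) \<and>
     (\<forall>c\<in>A. \<forall>i j. smooth_on (coord c ` cdom c) (\<lambda>x. gram A g c (cinv c x) $ i $ j))"

text \<open>The number \<open>\<omega> = sign G\<close>. It does not depend on the chosen chart, and neither does it depend
  on the point \<open>p\<close> if the manifold is connected.\<close>

definition metric_sign :: "'m chart set \<Rightarrow> 'm metric \<Rightarrow> 'm \<Rightarrow> real" where
  "metric_sign A g p = sgn (det (gram A g (chart_at A p) p))"

text \<open>The form with \<open>\<Omega>(\<partial>\<^sub>i,\<partial>\<^sub>j,\<partial>\<^sub>k) = \<surd>\<bar>G\<bar> \<epsilon>\<^sub>i\<^sub>j\<^sub>k\<close>; all charts of \<open>A\<close> are positively oriented, so the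
  choice of the chart does not matter.\<close>

definition volume_form ::
    "'m chart set \<Rightarrow> 'm metric \<Rightarrow> 'm \<Rightarrow> 'm tvec \<Rightarrow> 'm tvec \<Rightarrow> 'm tvec \<Rightarrow> real" where
  "volume_form A g p X Y Z =
     (let c = chart_at A p in
        sqrt \<bar>det (gram A g c p)\<bar> * det (vector [X c, Y c, Z c] :: real^3^3))"

definition cross_product ::
    "'m chart set \<Rightarrow> 'm metric \<Rightarrow> 'm \<Rightarrow> 'm tvec \<Rightarrow> 'm tvec \<Rightarrow> 'm tvec" where
  "cross_product A g p X Y =
     (THE W. W \<in> tangent_space A p \<and>
        (\<forall>Z\<in>tangent_space A p. g p W Z = volume_form A g p X Y Z))"


section \<open>Levi-Civita connection\<close>

text \<open>\<open>D p v Y\<close> is \<open>\<nabla>\<^sub>v Y\<close> for a tangent vector \<open>v\<close> at \<open>p\<close> and a vector field \<open>Y\<close> that is smooth on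
  some open neighbourhood \<open>U\<close> of \<open>p\<close>. That only the germ of \<open>Y\<close> at \<open>p\<close> matters is a consequence of
  the Leibniz rule, with \<open>f\<close> the indicator function of a neighbourhood of \<open>p\<close>.\<close>

type_synonym 'm connection = "'m \<Rightarrow> 'm tvec \<Rightarrow> ('m \<Rightarrow> 'm tvec) \<Rightarrow> 'm tvec"

definition affine_connection :: "'m::topological_space chart set \<Rightarrow> 'm connection \<Rightarrow> bool" where
  "affine_connection A D \<longleftrightarrow>
     (\<forall>U X Y. smooth_field_on A U X \<and> smooth_field_on A U Y \<longrightarrow>
        smooth_field_on A U (\<lambda>p. D p (X p) Y)) \<and>
     (\<forall>U Y. smooth_field_on A U Y \<longrightarrow>
        (\<forall>p\<in>U. \<forall>v\<in>tangent_space A p. \<forall>w\<in>tangent_space A p. \<forall>a b.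
           D p (a \<odot> v \<oplus> b \<odot> w) Y = a \<odot> D p v Y \<oplus> b \<odot> D p w Y)) \<and>
     (\<forall>U Y Z. smooth_field_on A U Y \<and> smooth_field_on A U Z \<longrightarrow>
        (\<forall>p\<in>U. \<forall>v\<in>tangent_space A p.
           D p v (\<lambda>q. Y q \<oplus> Z q) = D p v Y \<oplus> D p v Z)) \<and>
     (\<forall>U f Y. smooth_fun_on A U f \<and> smooth_field_on A U Y \<longrightarrow>
        (\<forall>p\<in>U. \<forall>v\<in>tangent_space A p.
           D p v (\<lambda>q. f q \<odot> Y q) = dir_deriv A p v f \<odot> Y p \<oplus> f p \<odot> D p v Y))"

definition levi_civita ::
    "'m::topological_space chart set \<Rightarrow> 'm metric \<Rightarrow> 'm connection \<Rightarrow> bool" where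
  "levi_civita A g D \<longleftrightarrow>
     affine_connection A D \<and>
     (\<forall>U X Y. smooth_field_on A U X \<and> smooth_field_on A U Y \<longrightarrow>
        (\<forall>p\<in>U. D p (X p) Y = D p (Y p) X \<oplus> lie_bracket A X Y p)) \<and>
     (\<forall>U X Y Z. smooth_field_on A U X \<and> smooth_field_on A U Y \<and> smooth_field_on A U Z \<longrightarrow>
        (\<forall>p\<in>U. dir_deriv A p (X p) (\<lambda>q. g q (Y q) (Z q)) =
           g p (D p (X p) Y) (Z p) + g p (Y p) (D p (X p) Z)))"


section \<open>Curves\<close>

definition smooth_curve ::
    "'m::topological_space chart set \<Rightarrow> real set \<Rightarrow> (real \<Rightarrow> 'm) \<Rightarrow> bool" where
  "smooth_curve A I \<alpha> \<longleftrightarrow>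
     continuous_on I \<alpha> \<and> (\<forall>c\<in>A. smooth_on {t\<in>I. \<alpha> t \<in> cdom c} (coord c \<circ> \<alpha>))"

definition velocity :: "'m chart set \<Rightarrow> (real \<Rightarrow> 'm) \<Rightarrow> real \<Rightarrow> 'm tvec" where
  "velocity A \<alpha> t =
     (\<lambda>c. if c \<in> A \<and> \<alpha> t \<in> cdom c then vector_derivative (coord c \<circ> \<alpha>) (at t) else 0)"

text \<open>The covariant derivative of a vector field \<open>V\<close> along \<open>\<alpha>\<close>: if \<open>V = \<Sum>\<^sub>j V\<^sup>j \<partial>\<^sub>j\<close> in a chart, then
  \<open>\<nabla>\<^sub>\<alpha>\<^sub>' V = \<Sum>\<^sub>j ((V\<^sup>j)' \<partial>\<^sub>j + V\<^sup>j \<nabla>\<^sub>\<alpha>\<^sub>' \<partial>\<^sub>j)\<close>.\<close>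

definition cov_deriv ::
    "'m chart set \<Rightarrow> 'm connection \<Rightarrow> (real \<Rightarrow> 'm) \<Rightarrow> (real \<Rightarrow> 'm tvec) \<Rightarrow> real \<Rightarrow> 'm tvec" where
  "cov_deriv A D \<alpha> V t =
     (\<lambda>c. if c \<in> A \<and> \<alpha> t \<in> cdom c then
        vector_derivative (\<lambda>s. V s c) (at t) +
        (\<Sum>j\<in>UNIV. (V t c $ j) *\<^sub>R D (\<alpha> t) (velocity A \<alpha> t) (coord_field A c j) c)
      else 0)"

definition accel :: "'m chart set \<Rightarrow> 'm connection \<Rightarrow> (real \<Rightarrow> 'm) \<Rightarrow> real \<Rightarrow> 'm tvec" where
  "accel A D \<alpha> = cov_deriv A D \<alpha> (velocity A \<alpha>)"


section \<open>Frenet frame, curvature and torsion\<close>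

definition arc_length_parametrized ::
    "'m chart set \<Rightarrow> 'm metric \<Rightarrow> real set \<Rightarrow> (real \<Rightarrow> 'm) \<Rightarrow> real \<Rightarrow> bool" where
  "arc_length_parametrized A g I \<alpha> \<epsilon>\<^sub>1 \<longleftrightarrow>
     \<epsilon>\<^sub>1 \<in> {1, -1} \<and> (\<forall>t\<in>I. g (\<alpha> t) (velocity A \<alpha> t) (velocity A \<alpha> t) = \<epsilon>\<^sub>1)"

definition eps2 ::
    "'m chart set \<Rightarrow> 'm metric \<Rightarrow> 'm connection \<Rightarrow> (real \<Rightarrow> 'm) \<Rightarrow> real \<Rightarrow> real" where
  "eps2 A g D \<alpha> t = sgn (g (\<alpha> t) (accel A D \<alpha> t) (accel A D \<alpha> t))"

definition eps3 ::
    "'m chart set \<Rightarrow> 'm metric \<Rightarrow> 'm connection \<Rightarrow> (real \<Rightarrow> 'm) \<Rightarrow> real \<Rightarrow> real \<Rightarrow> real" where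
  "eps3 A g D \<alpha> \<epsilon>\<^sub>1 t = metric_sign A g (\<alpha> t) * \<epsilon>\<^sub>1 * eps2 A g D \<alpha> t"

definition frenet_curvature ::
    "'m chart set \<Rightarrow> 'm metric \<Rightarrow> 'm connection \<Rightarrow> real set \<Rightarrow> (real \<Rightarrow> 'm) \<Rightarrow>
     (real \<Rightarrow> real) \<Rightarrow> (real \<Rightarrow> 'm tvec) \<Rightarrow> bool" where
  "frenet_curvature A g D I \<alpha> \<kappa> N \<longleftrightarrow>
     (\<forall>t\<in>I. N t \<in> tangent_space A (\<alpha> t) \<and> \<kappa> t > 0 \<and>
        accel A D \<alpha> t = (eps2 A g D \<alpha> t * \<kappa> t) \<odot> N t \<and>
        g (\<alpha> t) (N t) (N t) = eps2 A g D \<alpha> t)"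

definition binormal ::
    "'m chart set \<Rightarrow> 'm metric \<Rightarrow> 'm connection \<Rightarrow> (real \<Rightarrow> 'm) \<Rightarrow> real \<Rightarrow>
     (real \<Rightarrow> 'm tvec) \<Rightarrow> real \<Rightarrow> 'm tvec" where
  "binormal A g D \<alpha> \<epsilon>\<^sub>1 N t =
     eps3 A g D \<alpha> \<epsilon>\<^sub>1 t \<odot> cross_product A g (\<alpha> t) (velocity A \<alpha> t) (N t)"

definition frenet_torsion ::
    "'m chart set \<Rightarrow> 'm metric \<Rightarrow> 'm connection \<Rightarrow> real set \<Rightarrow> (real \<Rightarrow> 'm) \<Rightarrow> real \<Rightarrow>
     (real \<Rightarrow> real) \<Rightarrow> (real \<Rightarrow> 'm tvec) \<Rightarrow> (real \<Rightarrow> real) \<Rightarrow> bool" where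
  "frenet_torsion A g D I \<alpha> \<epsilon>\<^sub>1 \<kappa> N \<tau> \<longleftrightarrow>
     (\<forall>t\<in>I. cov_deriv A D \<alpha> N t =
        (- \<epsilon>\<^sub>1 * \<kappa> t) \<odot> velocity A \<alpha> t \<oplus>
        (eps3 A g D \<alpha> \<epsilon>\<^sub>1 t * \<tau> t) \<odot> binormal A g D \<alpha> \<epsilon>\<^sub>1 N t)"


section \<open>Equi-affine objects\<close>

definition affine_density ::
    "'m chart set \<Rightarrow> 'm metric \<Rightarrow> 'm connection \<Rightarrow> (real \<Rightarrow> 'm) \<Rightarrow> real \<Rightarrow> real" where
  "affine_density A g D \<alpha> t =
     volume_form A g (\<alpha> t) (velocity A \<alpha> t) (accel A D \<alpha> t) (cov_deriv A D \<alpha> (accel A D \<alpha>) t)"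

definition nondegenerate_curve ::
    "'m chart set \<Rightarrow> 'm metric \<Rightarrow> 'm connection \<Rightarrow> real set \<Rightarrow> (real \<Rightarrow> 'm) \<Rightarrow> bool" where
  "nondegenerate_curve A g D I \<alpha> \<longleftrightarrow> (\<forall>t\<in>I. affine_density A g D \<alpha> t \<noteq> 0)"

definition cartan_phi ::
    "'m chart set \<Rightarrow> 'm metric \<Rightarrow> 'm connection \<Rightarrow> (real \<Rightarrow> 'm) \<Rightarrow> real \<Rightarrow> real" where
  "cartan_phi A g D \<alpha> t = \<bar>affine_density A g D \<alpha> t\<bar> powr (- 1 / 6)"

definition cartan_e1 ::
    "'m chart set \<Rightarrow> 'm metric \<Rightarrow> 'm connection \<Rightarrow> (real \<Rightarrow> 'm) \<Rightarrow> real \<Rightarrow> 'm tvec" where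
  "cartan_e1 A g D \<alpha> t = cartan_phi A g D \<alpha> t \<odot> velocity A \<alpha> t"

definition cartan_deriv ::
    "'m chart set \<Rightarrow> 'm metric \<Rightarrow> 'm connection \<Rightarrow> (real \<Rightarrow> 'm) \<Rightarrow>
     (real \<Rightarrow> 'm tvec) \<Rightarrow> real \<Rightarrow> 'm tvec" where
  "cartan_deriv A g D \<alpha> V t = cartan_phi A g D \<alpha> t \<odot> cov_deriv A D \<alpha> V t"

definition cartan_e2 ::
    "'m chart set \<Rightarrow> 'm metric \<Rightarrow> 'm connection \<Rightarrow> (real \<Rightarrow> 'm) \<Rightarrow> real \<Rightarrow> 'm tvec" where
  "cartan_e2 A g D \<alpha> = cartan_deriv A g D \<alpha> (cartan_e1 A g D \<alpha>)"

definition cartan_e3 ::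
    "'m chart set \<Rightarrow> 'm metric \<Rightarrow> 'm connection \<Rightarrow> (real \<Rightarrow> 'm) \<Rightarrow> real \<Rightarrow> 'm tvec" where
  "cartan_e3 A g D \<alpha> = cartan_deriv A g D \<alpha> (cartan_e2 A g D \<alpha>)"

definition equi_affine_curvatures ::
    "'m chart set \<Rightarrow> 'm metric \<Rightarrow> 'm connection \<Rightarrow> real set \<Rightarrow> (real \<Rightarrow> 'm) \<Rightarrow>
     (real \<Rightarrow> real) \<Rightarrow> (real \<Rightarrow> real) \<Rightarrow> bool" where
  "equi_affine_curvatures A g D I \<alpha> k\<^sub>1 k\<^sub>2 \<longleftrightarrow>
     (\<forall>t\<in>I. cartan_deriv A g D \<alpha> (cartan_e3 A g D \<alpha>) t =
        k\<^sub>1 t \<odot> cartan_e1 A g D \<alpha> t \<oplus> k\<^sub>2 t \<odot> cartan_e2 A g D \<alpha> t)"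

end

theory Submission
  imports Defs
begin

text \<open>Write \<open>W = T \<times> N\<close>, so that \<open>\<epsilon>\<^sub>3\<tau>B = \<tau>W\<close>. Then \<open>\<Omega>(T, \<nabla>\<^sub>TT, \<nabla>\<^sub>T\<^sup>2T) = \<kappa>\<^sup>2\<tau> g(W,W)\<close>, and non-degeneracy gives
  \<open>\<tau> \<noteq> 0\<close> and \<open>g(W,W) \<noteq> 0\<close>; the Gram determinant of \<open>T, N, W\<close> then forces \<open>g(W,W) = \<epsilon>\<^sub>3\<close>. Hence
  \<open>\<phi>\<close> is constant, and the Cartan frame is obtained from \<open>T\<close> by covariant differentiation alone. The last
  Frenet equation is not needed as a vector identity: \<open>\<nabla>\<^sub>TW\<close> is known to lie in the span of \<open>T\<close> and \<open>N\<close>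
  from the definition of the equi-affine curvatures, and its products with \<open>T\<close> and \<open>N\<close> follow from
  metric compatibility along the curve. All products are computed in one chart with its Gram matrix, so
  that it is never needed that covariant derivatives along the curve are tangent vectors.\<close>

section \<open>Closure properties of smooth maps\<close>

text \<open>On an open set, equality on the set is equality near each of its points, so the
  derivatives agree there as well and the induction on \<open>k\<close> continues with them.\<close>

lemma Ck_on_cong:
  assumes "open S" "\<And>x. x \<in> S \<Longrightarrow> f x = g x" "Ck_on k S f"
  shows "Ck_on k S g"
  using assms(2,3)
proof (induction k arbitrary: f g)
  case 0
  then show ?case by (metis Ck_on.simps(1) continuous_on_cong)
next
  case (Suc k)
  have D: "(g has_derivative frechet_derivative f (at x)) (at x)" if "x \<in> S" for x
  proof (rule has_derivative_transform_within_open[OF _ assms(1) that])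
    show "(f has_derivative frechet_derivative f (at x)) (at x)"
      using Suc.prems(2) that by (simp add: frechet_derivative_works)
  qed (use Suc.prems(1) in auto)
  have "frechet_derivative f (at x) = frechet_derivative g (at x)" if "x \<in> S" for x
    using D[OF that] by (rule frechet_derivative_at)
  then have "Ck_on k S (\<lambda>x. frechet_derivative g (at x) v)" for v
    using Suc.IH[of "\<lambda>x. frechet_derivative f (at x) v" "\<lambda>x. frechet_derivative g (at x) v"]
      Suc.prems(2) by simp
  moreover have "g differentiable (at x)" if "x \<in> S" for x
    using D[OF that] by (auto simp: differentiable_def)
  ultimately show ?case by simp
qed

text \<open>Allows a derivative to be supplied by an explicit formula in place of
  \<open>frechet_derivative\<close>, which the sum, product and chain rules below produce.\<close>

lemma Ck_on_SucI:
  assumes "open S" "\<And>x. x \<in> S \<Longrightarrow> (f has_derivative f' x) (at x)"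
    and "\<And>v. Ck_on k S (\<lambda>x. f' x v)"
  shows "Ck_on (Suc k) S f"
proof -
  have "f' x = frechet_derivative f (at x)" if "x \<in> S" for x
    using assms(2)[OF that] by (rule frechet_derivative_at)
  then have "Ck_on k S (\<lambda>x. frechet_derivative f (at x) v)" for v
    using Ck_on_cong[OF assms(1) _ assms(3)] by simp
  then show ?thesis using assms(2) by (auto simp: differentiable_def)
qed

lemma Ck_on_SucD:
  assumes "Ck_on (Suc k) S f"
  shows "x \<in> S \<Longrightarrow> (f has_derivative frechet_derivative f (at x)) (at x)"
    and "Ck_on k S (\<lambda>x. frechet_derivative f (at x) v)"
  using assms by (simp_all add: frechet_derivative_works)

text \<open>Differentiability gives continuity at the bottom level. The product and chain rules use
  this because their derivatives still contain undifferentiated factors.\<close>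

lemma Ck_on_Suc_imp_Ck_on: "Ck_on (Suc k) S f \<Longrightarrow> Ck_on k S f"
proof (induction k arbitrary: f)
  case 0
  then show ?case
    by (auto intro!: continuous_at_imp_continuous_on differentiable_imp_continuous_within)
next
  case (Suc k)
  then show ?case by (metis Ck_on.simps(2))
qed

lemma Ck_on_const: "open S \<Longrightarrow> Ck_on k S (\<lambda>x. c)"
proof (induction k arbitrary: c)
  case (Suc k)
  then show ?case by (intro Ck_on_SucI[where f' = "\<lambda>x v. 0"]) auto
qed simp

lemma Ck_on_bounded_linear:
  assumes "open S" "bounded_linear L"
  shows "Ck_on k S f \<Longrightarrow> Ck_on k S (\<lambda>x. L (f x))"
proof (induction k arbitrary: f)
  case 0
  then show ?case using assms(2) by (simp add: bounded_linear.continuous_on)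
next
  case (Suc k)
  show ?case
    by (rule Ck_on_SucI[OF assms(1) bounded_linear.has_derivative[OF assms(2) Ck_on_SucD(1)[OF Suc.prems]]])
      (use Suc.IH Ck_on_SucD(2)[OF Suc.prems] in auto)
qed

lemma Ck_on_add:
  assumes "open S"
  shows "Ck_on k S f \<Longrightarrow> Ck_on k S g \<Longrightarrow> Ck_on k S (\<lambda>x. f x + g x)"
proof (induction k arbitrary: f g)
  case 0
  then show ?case by (simp add: continuous_on_add)
next
  case (Suc k)
  show ?case
    by (rule Ck_on_SucI[OF assms(1) has_derivative_add[OF Ck_on_SucD(1)[OF Suc.prems(1)] Ck_on_SucD(1)[OF Suc.prems(2)]]])
      (use Suc.IH Ck_on_SucD(2)[OF Suc.prems(1)] Ck_on_SucD(2)[OF Suc.prems(2)] in auto)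
qed

lemma Ck_on_scaleR:
  assumes "open S"
  shows "Ck_on k S f \<Longrightarrow> Ck_on k S g \<Longrightarrow> Ck_on k S (\<lambda>x. f x *\<^sub>R g x)"
proof (induction k arbitrary: f g)
  case 0
  then show ?case by (simp add: continuous_on_scaleR)
next
  case (Suc k)
  let ?D = "\<lambda>x v. f x *\<^sub>R frechet_derivative g (at x) v + frechet_derivative f (at x) v *\<^sub>R g x"
  show ?case
  proof (rule Ck_on_SucI[OF assms])
    fix x assume "x \<in> S"
    then show "((\<lambda>x. f x *\<^sub>R g x) has_derivative ?D x) (at x)"
      by (intro has_derivative_scaleR Ck_on_SucD(1)[OF Suc.prems(1)] Ck_on_SucD(1)[OF Suc.prems(2)])
  next
    fix v
    show "Ck_on k S (\<lambda>x. ?D x v)"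
      by (rule Ck_on_add[OF assms Suc.IH[OF Ck_on_Suc_imp_Ck_on[OF Suc.prems(1)] Ck_on_SucD(2)[OF Suc.prems(2)]]
            Suc.IH[OF Ck_on_SucD(2)[OF Suc.prems(1)] Ck_on_Suc_imp_Ck_on[OF Suc.prems(2)]]])
  qed
qed

lemma Ck_on_sum:
  assumes "open S" "finite B" "\<And>b. b \<in> B \<Longrightarrow> Ck_on k S (f b)"
  shows "Ck_on k S (\<lambda>x. \<Sum>b\<in>B. f b x)"
  using assms(2,3)
  by (induction B) (auto intro: Ck_on_const Ck_on_add assms(1))

lemma Ck_on_compose:
  fixes f :: "'b::euclidean_space \<Rightarrow> 'c::real_normed_vector" and h :: "'a::euclidean_space \<Rightarrow> 'b"
  assumes "open S" "h ` S \<subseteq> T"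
  shows "Ck_on k T f \<Longrightarrow> Ck_on k S h \<Longrightarrow> Ck_on k S (\<lambda>x. f (h x))"
proof (induction k arbitrary: f)
  case 0
  then show ?case using assms(2) continuous_on_compose2 by (metis Ck_on.simps(1))
next
  case (Suc k)
  have fd: "(f has_derivative frechet_derivative f (at (h x))) (at (h x))" if "x \<in> S" for x
    using Ck_on_SucD(1)[OF Suc.prems(1)] that assms(2) by blast
  \<comment> \<open>The chain rule is expanded in a basis: each summand is a scalar function times
    the derivative of \<open>f\<close> in a fixed direction \<open>b\<close>, taken at
    \<open>h x\<close>. The induction hypothesis applies to the latter, since it holds for every
    outer function.\<close>
  let ?D = "\<lambda>x v. \<Sum>b\<in>Basis. (frechet_derivative h (at x) v \<bullet> b) *\<^sub>R frechet_derivative f (at (h x)) b"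
  show ?case
  proof (rule Ck_on_SucI[OF assms(1)])
    fix x assume x: "x \<in> S"
    interpret L: bounded_linear "frechet_derivative f (at (h x))"
      using fd[OF x] by (rule has_derivative_bounded_linear)
    have "?D x = (\<lambda>v. frechet_derivative f (at (h x)) (frechet_derivative h (at x) v))"
      by (rule ext, subst (2) euclidean_representation[symmetric]) (simp add: L.sum L.scaleR)
    then show "((\<lambda>x. f (h x)) has_derivative ?D x) (at x)"
      using has_derivative_compose[OF Ck_on_SucD(1)[OF Suc.prems(2) x] fd[OF x]] by simp
  next
    fix v
    show "Ck_on k S (\<lambda>x. ?D x v)"
      by (intro Ck_on_sum Ck_on_scaleR assms(1) finite_Basis Suc.IH Ck_on_SucD(2)[OF Suc.prems(1)]
          Ck_on_Suc_imp_Ck_on[OF Suc.prems(2)] Ck_on_bounded_linear[OF _ bounded_linear_inner_left]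
          Ck_on_SucD(2)[OF Suc.prems(2)])
  qed
qed

section \<open>Passage from finite order to smooth maps\<close>

lemma smooth_onI: "(\<And>k. Ck_on k S f) \<Longrightarrow> smooth_on S f"
  unfolding smooth_on_def by (rule allI)

lemma smooth_onD: "smooth_on S f \<Longrightarrow> Ck_on k S f"
  unfolding smooth_on_def by (rule spec)

lemma smooth_on_cong:
  assumes "open S" "smooth_on S f" "\<And>x. x \<in> S \<Longrightarrow> f x = g x"
  shows "smooth_on S g"
  by (rule smooth_onI, rule Ck_on_cong[OF assms(1,3) smooth_onD[OF assms(2)]])

lemma smooth_on_compose:
  fixes f :: "'b::euclidean_space \<Rightarrow> 'c::real_normed_vector" and h :: "'a::euclidean_space \<Rightarrow> 'b"
  assumes "smooth_on T f" "smooth_on S h" "open S" "h ` S \<subseteq> T"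
  shows "smooth_on S (\<lambda>x. f (h x))"
  by (rule smooth_onI, rule Ck_on_compose[OF assms(3,4) smooth_onD[OF assms(1)] smooth_onD[OF assms(2)]])

lemma smooth_on_add:
  assumes "open S" "smooth_on S f" "smooth_on S g"
  shows "smooth_on S (\<lambda>x. f x + g x)"
  by (rule smooth_onI, rule Ck_on_add[OF assms(1) assms(2,3)[THEN smooth_onD]])

lemma smooth_on_const: "open S \<Longrightarrow> smooth_on S (\<lambda>x. c)"
  by (rule smooth_onI, rule Ck_on_const)

lemma smooth_on_scaleR:
  assumes "open S" "smooth_on S f" "smooth_on S g"
  shows "smooth_on S (\<lambda>x. f x *\<^sub>R g x)"
  by (rule smooth_onI, rule Ck_on_scaleR[OF assms(1) assms(2,3)[THEN smooth_onD]])

lemma smooth_on_sum: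
  assumes "open S" "finite B" "\<And>b. b \<in> B \<Longrightarrow> smooth_on S (f b)"
  shows "smooth_on S (\<lambda>x. \<Sum>b\<in>B. f b x)"
  by (rule smooth_onI, rule Ck_on_sum[OF assms(1,2) smooth_onD[OF assms(3)]])

lemma smooth_on_bounded_linear:
  assumes "bounded_linear L" "open S" "smooth_on S f"
  shows "smooth_on S (\<lambda>x. L (f x))"
  by (rule smooth_onI, rule Ck_on_bounded_linear[OF assms(2,1) smooth_onD[OF assms(3)]])

lemma smooth_on_frechet_derivative:
  "smooth_on S f \<Longrightarrow> smooth_on S (\<lambda>x. frechet_derivative f (at x) v)"
  by (rule smooth_onI, rule Ck_on_SucD(2)[OF smooth_onD])

lemma smooth_on_has_derivative:
  "smooth_on S f \<Longrightarrow> x \<in> S \<Longrightarrow> (f has_derivative frechet_derivative f (at x)) (at x)"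
  by (rule Ck_on_SucD(1)[OF smooth_onD])

lemma smooth_on_has_vector_derivative:
  assumes "smooth_on S f" "t \<in> S"
  shows "(f has_vector_derivative vector_derivative f (at t)) (at t)"
  by (rule vector_derivative_works[THEN iffD1, OF differentiableI[OF smooth_on_has_derivative[OF assms]]])

text \<open>The vector derivative is the Frechet derivative in the direction 1, by linearity in the
  real increment.\<close>

lemma smooth_on_vector_derivative:
  assumes "open S" "smooth_on S f"
  shows "smooth_on S (\<lambda>t. vector_derivative f (at t))"
proof (rule smooth_on_cong[OF assms(1) smooth_on_frechet_derivative[OF assms(2), of 1]])
  fix t assume "t \<in> S"
  then have D: "(f has_derivative frechet_derivative f (at t)) (at t)"
    by (rule smooth_on_has_derivative[OF assms(2)])
  have "frechet_derivative f (at t) = (\<lambda>r. r *\<^sub>R frechet_derivative f (at t) 1)"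
  proof
    fix r :: real
    show "frechet_derivative f (at t) r = r *\<^sub>R frechet_derivative f (at t) 1"
      using linear_cmul[OF has_derivative_linear[OF D], of r 1]
      by (simp only: real_scaleR_def mult_1_right)
  qed
  then have "(f has_vector_derivative frechet_derivative f (at t) 1) (at t)"
    unfolding has_vector_derivative_def by (rule has_derivative_eq_rhs[OF D])
  then show "frechet_derivative f (at t) 1 = vector_derivative f (at t)"
    by (simp add: vector_derivative_at)
qed


section \<open>Coordinates of tangent vectors\<close>

text \<open>The field on \<open>cdom c\<close> with constant components \<open>x\<close> in the
  chart \<open>c\<close>. Coordinate fields are the case of axis vectors; a general \<open>x\<close>
  serves to extend a given tangent vector to a smooth field, since the axioms of a connection speak
  of fields.\<close>

definition const_field :: "'m chart set \<Rightarrow> 'm chart \<Rightarrow> real^3 \<Rightarrow> 'm \<Rightarrow> 'm tvec" where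
  "const_field A c x p =
     (\<lambda>d. if c \<in> A \<and> d \<in> A \<and> p \<in> cdom c \<inter> cdom d then jac c d p x else 0)"

lemma coord_field_eq_const_field: "coord_field A c i = const_field A c (axis i 1)"
  by (intro ext) (simp add: coord_field_def const_field_def)

lemma tadd_apply [simp]: "(u \<oplus> v) c = u c + v c"
  by (simp add: tadd_def)

lemma tscale_apply [simp]: "(a \<odot> v) c = a *\<^sub>R v c"
  by (simp add: tscale_def)

lemma tscale_tscale [simp]: "a \<odot> b \<odot> v = (a * b) \<odot> v"
  by (intro ext) simp

lemma tzero_apply [simp]: "tzero c = 0"
  by (simp add: tzero_def)

locale oriented_manifold =
  fixes A :: "'m::{t2_space,second_countable_topology} chart set"
  assumes atlas: "oriented_atlas A"
begin

section \<open>Charts and changes of coordinates\<close>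

lemma is_chart: "c \<in> A \<Longrightarrow> is_chart c"
  using atlas by (simp add: oriented_atlas_def)

lemma open_cdom: "c \<in> A \<Longrightarrow> open (cdom c)"
  using is_chart is_chart_def by blast

lemma chart_at: "chart_at A p \<in> A" "p \<in> cdom (chart_at A p)"
proof -
  have "\<exists>c. c \<in> A \<and> p \<in> cdom c"
    using atlas UNIV_I[of p] by (simp only: oriented_atlas_def) (metis UN_E)
  then have "chart_at A p \<in> A \<and> p \<in> cdom (chart_at A p)"
    unfolding chart_at_def by (rule someI_ex)
  then show "chart_at A p \<in> A" "p \<in> cdom (chart_at A p)" by auto
qed

lemma cinv_coord [simp]: "c \<in> A \<Longrightarrow> p \<in> cdom c \<Longrightarrow> cinv c (coord c p) = p"
  using is_chart[of c] by (auto simp: is_chart_def homeomorphism_def)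

lemma open_coord_image:
  assumes "c \<in> A" "open U"
  shows "open (coord c ` (cdom c \<inter> U))"
proof -
  have "open (coord c ` cdom c)" "homeomorphism (cdom c) (coord c ` cdom c) (coord c) (cinv c)"
    using is_chart[OF assms(1)] by (auto simp: is_chart_def)
  moreover have "openin (top_of_set (cdom c)) (cdom c \<inter> U)"
    using assms(2) by (rule openin_open_Int)
  ultimately show ?thesis
    using homeomorphism_imp_open_map openin_open_trans by blast
qed

lemma transition_coord: "c \<in> A \<Longrightarrow> p \<in> cdom c \<Longrightarrow> transition c d (coord c p) = coord d p"
  by (simp add: transition_def)

lemma smooth_transition:
  "c \<in> A \<Longrightarrow> d \<in> A \<Longrightarrow> smooth_on (coord c ` (cdom c \<inter> cdom d)) (transition c d)"
  using atlas by (simp add: oriented_atlas_def)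

lemma transition_has_derivative:
  assumes "c \<in> A" "d \<in> A" "p \<in> cdom c" "p \<in> cdom d"
  shows "(transition c d has_derivative jac c d p) (at (coord c p))"
  unfolding jac_def
  by (rule smooth_on_has_derivative[OF smooth_transition[OF assms(1,2)]]) (use assms in auto)

lemma linear_jac:
  "c \<in> A \<Longrightarrow> d \<in> A \<Longrightarrow> p \<in> cdom c \<Longrightarrow> p \<in> cdom d \<Longrightarrow> linear (jac c d p)"
  using transition_has_derivative has_derivative_linear by blast

text \<open>The cocycle rule of the Jacobians: the chain rule for \<open>transition d e\<close>
  after \<open>transition c d\<close>, which agrees with \<open>transition c e\<close> near
  \<open>coord c p\<close>.\<close>

lemma jac_jac:
  assumes "c \<in> A" "d \<in> A" "e \<in> A" "p \<in> cdom c" "p \<in> cdom d" "p \<in> cdom e"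
  shows "jac d e p (jac c d p v) = jac c e p v"
proof -
  have "((\<lambda>x. transition d e (transition c d x)) has_derivative (\<lambda>v. jac d e p (jac c d p v)))
      (at (coord c p))"
    using has_derivative_compose[OF transition_has_derivative[OF assms(1,2,4,5)]]
      transition_has_derivative[OF assms(2,3,5,6)] transition_coord[OF assms(1,4)] by simp
  then have "(transition c e has_derivative (\<lambda>v. jac d e p (jac c d p v))) (at (coord c p))"
    by (rule has_derivative_transform_within_open[OF _ open_coord_image[OF assms(1) open_cdom[OF assms(2)]]])
      (use assms in \<open>auto simp: transition_coord\<close>)
  from has_derivative_unique[OF this transition_has_derivative[OF assms(1,3,4,6)]]
  show ?thesis by metis
qed

lemma jac_same [simp]:
  assumes "c \<in> A" "p \<in> cdom c"
  shows "jac c c p v = v"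
proof -
  have "(transition c c has_derivative (\<lambda>v. v)) (at (coord c p))"
    by (rule has_derivative_transform_within_open[OF has_derivative_ident open_coord_image[OF assms(1) open_cdom[OF assms(1)]]])
      (use assms in \<open>auto simp: transition_coord\<close>)
  from has_derivative_unique[OF this transition_has_derivative[OF assms(1,1,2,2)]]
  show ?thesis by metis
qed

section \<open>Tangent spaces and their linear operations\<close>

lemma tangent_space_zero:
  assumes "v \<in> tangent_space A p" "c \<notin> A \<or> p \<notin> cdom c"
  shows "v c = 0"
proof -
  have "\<forall>c. c \<notin> A \<or> p \<notin> cdom c \<longrightarrow> v c = 0"
    using assms(1) unfolding tangent_space_def by (rule CollectE) (rule conjunct1)
  from mp[OF spec[OF this, of c] assms(2)] show ?thesis .
qed

lemma tangent_space_jac: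
  assumes "v \<in> tangent_space A p" and c: "c \<in> A" "d \<in> A" "p \<in> cdom c" "p \<in> cdom d"
  shows "v d = jac c d p (v c)"
proof -
  have "\<forall>c\<in>A. \<forall>d\<in>A. p \<in> cdom c \<inter> cdom d \<longrightarrow> v d = jac c d p (v c)"
    using assms(1) unfolding tangent_space_def by (rule CollectE) (rule conjunct2)
  then show ?thesis using c by blast
qed

lemma tangent_spaceI:
  assumes "\<And>c. c \<notin> A \<or> p \<notin> cdom c \<Longrightarrow> v c = 0"
    and "\<And>c d. c \<in> A \<Longrightarrow> d \<in> A \<Longrightarrow> p \<in> cdom c \<Longrightarrow> p \<in> cdom d \<Longrightarrow> v d = jac c d p (v c)"
  shows "v \<in> tangent_space A p"
  unfolding tangent_space_def
  by (intro CollectI conjI allI impI ballI, erule assms(1), rule assms(2)) blast+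

lemma tangent_tadd:
  assumes "u \<in> tangent_space A p" "v \<in> tangent_space A p"
  shows "u \<oplus> v \<in> tangent_space A p"
proof (rule tangent_spaceI)
  fix c assume "c \<notin> A \<or> p \<notin> cdom c"
  then show "(u \<oplus> v) c = 0"
    using assms[THEN tangent_space_zero] by simp
next
  fix c d assume c: "c \<in> A" "d \<in> A" "p \<in> cdom c" "p \<in> cdom d"
  show "(u \<oplus> v) d = jac c d p ((u \<oplus> v) c)"
    unfolding tadd_apply linear_add[OF linear_jac[OF c]]
    by (simp only: tangent_space_jac[OF assms(1) c, symmetric] tangent_space_jac[OF assms(2) c, symmetric])
qed

lemma tangent_tscale:
  assumes "v \<in> tangent_space A p"
  shows "a \<odot> v \<in> tangent_space A p"
proof (rule tangent_spaceI)
  fix c assume "c \<notin> A \<or> p \<notin> cdom c"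
  then show "(a \<odot> v) c = 0"
    using tangent_space_zero[OF assms] by simp
next
  fix c d assume c: "c \<in> A" "d \<in> A" "p \<in> cdom c" "p \<in> cdom d"
  show "(a \<odot> v) d = jac c d p ((a \<odot> v) c)"
    unfolding tscale_apply linear_cmul[OF linear_jac[OF c]]
    by (simp only: tangent_space_jac[OF assms c, symmetric])
qed

section \<open>Fields with constant components and expansion in coordinate fields\<close>

lemma const_field_tangent: "const_field A c x p \<in> tangent_space A p"
  by (rule tangent_spaceI) (auto simp: const_field_def jac_jac linear_0[OF linear_jac])

lemma const_field_apply [simp]: "c \<in> A \<Longrightarrow> p \<in> cdom c \<Longrightarrow> const_field A c x p c = x"
  by (simp add: const_field_def)

text \<open>The transformation law recovers a tangent vector from its components in one chart. Read
  from right to left, this extends \<open>u\<close> to a field on the whole chart domain.\<close>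

lemma const_field_components:
  assumes "u \<in> tangent_space A p" "c \<in> A" "p \<in> cdom c"
  shows "const_field A c (u c) p = u"
proof (rule ext)
  fix d
  show "const_field A c (u c) p d = u d"
  proof (cases "d \<in> A \<and> p \<in> cdom d")
    case True
    then show ?thesis
      using tangent_space_jac[OF assms(1,2) _ assms(3), of d] assms(2,3)
      by (simp only: const_field_def) simp
  next
    case False
    then show ?thesis
      using tangent_space_zero[OF assms(1), of d] by (auto simp: const_field_def)
  qed
qed

lemma tangent_eqI:
  assumes "u \<in> tangent_space A p" "v \<in> tangent_space A p" "c \<in> A" "p \<in> cdom c" "u c = v c"
  shows "u = v"
  using assms const_field_components by metis

text \<open>Tangent vectors form a set of functions, not a vector space type, so linearity is
  assumed only on that set and applied to an explicit combination of the three coordinate vectors.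
  It is used both for the metric and for the connection.\<close>

lemma tangent_linear_expand:
  fixes F :: "'m tvec \<Rightarrow> 'b::real_vector"
  assumes lin: "\<And>u v a b. u \<in> tangent_space A p \<Longrightarrow> v \<in> tangent_space A p \<Longrightarrow>
        F (a \<odot> u \<oplus> b \<odot> v) = a *\<^sub>R F u + b *\<^sub>R F v"
    and u: "u \<in> tangent_space A p" and c: "c \<in> A" "p \<in> cdom c"
  shows "F u = (\<Sum>k\<in>UNIV. (u c $ k) *\<^sub>R F (coord_field A c k p))"
proof -
  let ?e = "\<lambda>k. coord_field A c k p"
  have e: "?e k \<in> tangent_space A p" for k
    by (simp add: coord_field_eq_const_field const_field_tangent)
  \<comment> \<open>The outer coefficient 1 brings the three-term sum into the two-term form of
    \<open>lin\<close>, which is then applied twice.\<close>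
  let ?w = "1 \<odot> ((u c $ 1) \<odot> ?e 1 \<oplus> (u c $ 2) \<odot> ?e 2) \<oplus> (u c $ 3) \<odot> ?e 3"
  have e2: "(u c $ 1) \<odot> ?e 1 \<oplus> (u c $ 2) \<odot> ?e 2 \<in> tangent_space A p"
    by (intro tangent_tadd tangent_tscale e)
  have "u = ?w"
    by (rule tangent_eqI[OF u tangent_tadd[OF tangent_tscale[OF e2] tangent_tscale[OF e]] c])
      (simp add: coord_field_eq_const_field c vec_eq_iff forall_3 axis_def)
  then have "F u = F ?w" by (rule arg_cong)
  also have "\<dots> = (\<Sum>k\<in>UNIV. (u c $ k) *\<^sub>R F (?e k))"
    by (simp add: lin[OF e2 e] lin[OF e e] sum_3)
  finally show ?thesis .
qed

text \<open>In a chart \<open>d\<close> the components are the derivative of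
  \<open>transition c d\<close> in the fixed direction \<open>x\<close>, taken at
  \<open>transition d c y\<close>, the \<open>c\<close>-coordinates of the point with
  \<open>d\<close>-coordinates \<open>y\<close>. This is a composition of smooth maps.\<close>

lemma smooth_const_field:
  assumes "c \<in> A"
  shows "smooth_field_on A (cdom c) (const_field A c x)"
  unfolding smooth_field_on_def
proof (intro conjI ballI)
  fix d assume d: "d \<in> A"
  let ?S = "coord d ` (cdom d \<inter> cdom c)"
  have S: "open ?S" by (rule open_coord_image[OF d open_cdom[OF assms]])
  have "smooth_on ?S (\<lambda>y. frechet_derivative (transition c d) (at (transition d c y)) x)"
    by (rule smooth_on_compose[OF smooth_on_frechet_derivative[OF smooth_transition[OF assms d]]
          smooth_transition[OF d assms] S]) (use d in \<open>auto simp: transition_coord\<close>)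
  then show "smooth_on ?S (\<lambda>y. const_field A c x (cinv d y) d)"
    by (rule smooth_on_cong[OF S])
      (use assms d in \<open>auto simp: const_field_def jac_def transition_coord\<close>)
qed (use assms in \<open>auto simp: open_cdom const_field_tangent\<close>)

text \<open>The chain rule through the change of coordinates cancels the Jacobian in the components
  of \<open>v\<close>; this frees \<open>dir_deriv\<close> from the arbitrary choice made by
  \<open>chart_at\<close>.\<close>

lemma dir_deriv_chart:
  assumes c: "c \<in> A" "p \<in> cdom c" and v: "v \<in> tangent_space A p"
    and f: "((\<lambda>x. f (cinv c x)) has_derivative f') (at (coord c p))"
  shows "dir_deriv A p v f = f' (v c)"
proof -
  define d where "d = chart_at A p"
  have d: "d \<in> A" "p \<in> cdom d" unfolding d_def by (rule chart_at)+
  have "((\<lambda>x. f (cinv c (transition d c x))) has_derivative (\<lambda>v. f' (jac d c p v))) (at (coord d p))"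
    using has_derivative_compose[OF transition_has_derivative[OF d(1) c(1) d(2) c(2)]] f
      transition_coord[OF d] by simp
  then have "((\<lambda>x. f (cinv d x)) has_derivative (\<lambda>v. f' (jac d c p v))) (at (coord d p))"
    by (rule has_derivative_transform_within_open[OF _ open_coord_image[OF d(1) open_cdom[OF c(1)]]])
      (use c d in \<open>auto simp: transition_coord\<close>)
  then have "frechet_derivative (\<lambda>x. f (cinv d x)) (at (coord d p)) = (\<lambda>v. f' (jac d c p v))"
    using frechet_derivative_at by metis
  then show ?thesis
    using tangent_space_jac[OF v d(1) c(1) d(2) c(2)] by (simp add: dir_deriv_def Let_def d_def[symmetric])
qed

end

section \<open>The metric in coordinates\<close>

lemma inner_matrix_expand:
  fixes G :: "real^3^3"
  shows "x \<bullet> (G *v y) = (\<Sum>i\<in>UNIV. \<Sum>j\<in>UNIV. x $ i * y $ j * G $ i $ j)"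
  by (simp add: inner_vec_def matrix_vector_mult_def sum_3 algebra_simps)

text \<open>If \<open>M\<close> has the rows \<open>x\<close>, \<open>y\<close>, \<open>z\<close>,
  then the entries of \<open>M ** G ** transpose M\<close> are their mutual products with respect to
  \<open>G\<close>. The hypotheses make this matrix diagonal.\<close>

lemma det_congruence_diagonal:
  fixes G :: "real^3^3"
  assumes "x \<bullet> (G *v y) = 0" "y \<bullet> (G *v x) = 0" "x \<bullet> (G *v z) = 0" "z \<bullet> (G *v x) = 0"
    "y \<bullet> (G *v z) = 0" "z \<bullet> (G *v y) = 0"
  shows "(x \<bullet> (G *v x)) * (y \<bullet> (G *v y)) * (z \<bullet> (G *v z)) = (det (vector [x, y, z] :: real^3^3))\<^sup>2 * det G"
proof -
  let ?M = "vector [x, y, z] :: real^3^3"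
  have "(?M ** G ** transpose ?M) $ i $ j = ?M $ i \<bullet> (G *v (?M $ j))" for i j
    by (simp add: inner_vec_def matrix_vector_mult_def matrix_matrix_mult_def transpose_def sum_3 algebra_simps)
  then have "det (?M ** G ** transpose ?M) = (x \<bullet> (G *v x)) * (y \<bullet> (G *v y)) * (z \<bullet> (G *v z))"
    using assms by (simp add: det_3 vector_3)
  then show ?thesis by (simp add: det_mul det_transpose power2_eq_square mult_ac)
qed

locale pseudo_riemannian_manifold = oriented_manifold A
  for A :: "'m::{t2_space,second_countable_topology} chart set" +
  fixes g :: "'m metric"
  assumes metric: "pseudo_riemannian_metric A g"
begin

lemma metric_linear_left:
  "u \<in> tangent_space A p \<Longrightarrow> v \<in> tangent_space A p \<Longrightarrow> w \<in> tangent_space A p \<Longrightarrow>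
    g p (a \<odot> u \<oplus> b \<odot> v) w = a * g p u w + b * g p v w"
  using metric by (simp add: pseudo_riemannian_metric_def)

lemma metric_sym:
  "u \<in> tangent_space A p \<Longrightarrow> v \<in> tangent_space A p \<Longrightarrow> g p u v = g p v u"
  using metric by (simp add: pseudo_riemannian_metric_def)

lemma metric_nondegenerate:
  "u \<in> tangent_space A p \<Longrightarrow> (\<And>w. w \<in> tangent_space A p \<Longrightarrow> g p u w = 0) \<Longrightarrow> u = tzero"
  using metric by (simp add: pseudo_riemannian_metric_def)

text \<open>Both arguments are expanded in coordinate vectors; linearity in the second comes from
  symmetry.\<close>

lemma metric_coords:
  assumes u: "u \<in> tangent_space A p" and v: "v \<in> tangent_space A p" and c: "c \<in> A" "p \<in> cdom c"
  shows "g p u v = u c \<bullet> (gram A g c p *v v c)"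
proof -
  have e: "coord_field A c i p \<in> tangent_space A p" for i
    by (simp add: coord_field_eq_const_field const_field_tangent)
  have "g p u v = (\<Sum>i\<in>UNIV. (u c $ i) *\<^sub>R g p (coord_field A c i p) v)"
    by (rule tangent_linear_expand[OF _ u c]) (simp only: metric_linear_left v real_scaleR_def)
  moreover have "g p (coord_field A c i p) v = (\<Sum>j\<in>UNIV. (v c $ j) *\<^sub>R gram A g c p $ i $ j)" for i
  proof -
    have "g p (coord_field A c i p) v = g p v (coord_field A c i p)"
      by (rule metric_sym[OF e v])
    also have "\<dots> = (\<Sum>j\<in>UNIV. (v c $ j) *\<^sub>R g p (coord_field A c j p) (coord_field A c i p))"
      by (rule tangent_linear_expand[OF _ v c]) (simp only: metric_linear_left e real_scaleR_def)
    finally show ?thesis by (simp add: gram_def metric_sym[OF e e, of _ i])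
  qed
  ultimately show ?thesis by (simp add: inner_matrix_expand sum_distrib_left mult_ac)
qed

text \<open>A vector in the kernel of the Gram matrix gives the components of a tangent vector
  orthogonal to the whole tangent space.\<close>

lemma gram_nondegenerate:
  assumes c: "c \<in> A" "p \<in> cdom c"
  shows "det (gram A g c p) \<noteq> 0"
proof -
  have "w = 0" if w: "gram A g c p *v w = 0" for w
  proof -
    let ?W = "const_field A c w p"
    have "g p ?W u = 0" if u: "u \<in> tangent_space A p" for u
      using metric_coords[OF u const_field_tangent c] w c metric_sym[OF u const_field_tangent] by simp
    then have "?W = tzero" by (rule metric_nondegenerate[OF const_field_tangent])
    then show "w = 0" using const_field_apply[OF c] tzero_apply by metis
  qed
  then have "invertible (gram A g c p)"
    using matrix_left_invertible_ker invertible_left_inverse by blast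
  then show ?thesis by (simp add: invertible_det_nz)
qed

text \<open>Existence is the raising of an index: the covector \<Omega>(X,Y,.) is multiplied by the
  inverse Gram matrix. Uniqueness is non-degeneracy of the metric. Together they justify the
  definite description in \<open>cross_product\<close>.\<close>

lemma cross_product:
  assumes "X \<in> tangent_space A p" "Y \<in> tangent_space A p"
  shows cross_product_tangent: "cross_product A g p X Y \<in> tangent_space A p"
    and metric_cross_product:
      "\<And>Z. Z \<in> tangent_space A p \<Longrightarrow> g p (cross_product A g p X Y) Z = volume_form A g p X Y Z"
proof -
  define c where "c = chart_at A p"
  have c: "c \<in> A" "p \<in> cdom c" unfolding c_def by (rule chart_at)+
  define G where "G = gram A g c p"
  \<comment> \<open>The determinant with rows \<open>X c\<close>, \<open>Y c\<close>,
    \<open>Z c\<close> is the Euclidean triple product, so \<open>a\<close> holds the components of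
    the covector \<Omega>(X,Y,.).\<close>
  define a where "a = sqrt \<bar>det G\<bar> *\<^sub>R cross3 (X c) (Y c)"
  have a: "volume_form A g p X Y Z = a \<bullet> Z c" for Z
    by (simp add: volume_form_def c_def[symmetric] Let_def G_def[symmetric] a_def det_3 vector_3
        cross3_simps)
  have "invertible G"
    using gram_nondegenerate[OF c] by (simp add: invertible_det_nz G_def)
  then obtain H where "G ** H = mat 1" by (auto simp: invertible_def)
  then have H: "G *v (H *v a) = a" by (simp add: matrix_vector_mul_assoc)
  let ?P = "\<lambda>W. W \<in> tangent_space A p \<and>
        (\<forall>Z\<in>tangent_space A p. g p W Z = volume_form A g p X Y Z)"
  have "?P (const_field A c (H *v a) p)"
    using metric_coords[OF _ const_field_tangent c] c
    by (auto simp: const_field_tangent a G_def[symmetric] H metric_sym[OF const_field_tangent] inner_commute)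
  moreover have "W = W'" if W: "?P W" "?P W'" for W W'
  proof -
    have "1 \<odot> W \<oplus> (-1) \<odot> W' = tzero"
      by (rule metric_nondegenerate[of _ p])
        (use W in \<open>auto simp: metric_linear_left intro!: tangent_tadd tangent_tscale\<close>)
    then have "(1 \<odot> W \<oplus> (-1) \<odot> W') d = tzero d" for d by (rule fun_cong)
    then show ?thesis by (intro ext) simp
  qed
  ultimately have "?P (cross_product A g p X Y)"
    unfolding cross_product_def by (intro theI[of ?P]) auto
  then show "cross_product A g p X Y \<in> tangent_space A p"
    and "\<And>Z. Z \<in> tangent_space A p \<Longrightarrow> g p (cross_product A g p X Y) Z = volume_form A g p X Y Z"
    by auto
qed

text \<open>The Gram determinant of \<open>X, Y, W\<close> is \<open>\<omega> \<Omega>(X,Y,W)\<^sup>2 = \<omega> g(W,W)\<^sup>2\<close>, and \<open>g(W,W)\<close> is cancelled.\<close>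

lemma metric_cross_product_self:
  assumes X: "X \<in> tangent_space A p" and Y: "Y \<in> tangent_space A p" and "g p X Y = 0"
    and W: "W = cross_product A g p X Y" "g p W W \<noteq> 0"
  shows "g p X X * g p Y Y = metric_sign A g p * g p W W"
proof -
  define c where "c = chart_at A p"
  have c: "c \<in> A" "p \<in> cdom c" unfolding c_def by (rule chart_at)+
  define G where "G = gram A g c p"
  define \<delta> where "\<delta> = det (vector [X c, Y c, W c] :: real^3^3)"
  note Wt = cross_product_tangent[OF X Y, folded W(1)]
  have vol: "g p W Z = sqrt \<bar>det G\<bar> * det (vector [X c, Y c, Z c] :: real^3^3)"
    if "Z \<in> tangent_space A p" for Z
    using metric_cross_product[OF X Y that]
    by (simp add: W(1)[symmetric] volume_form_def c_def[symmetric] Let_def G_def[symmetric])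
  have orth: "g p W X = 0" "g p W Y = 0"
    by (simp_all add: vol X Y det_3 vector_3)
  have "g p X X * g p Y Y * g p W W = \<delta>\<^sup>2 * det G"
    unfolding metric_coords[OF X X c] metric_coords[OF Y Y c] metric_coords[OF Wt Wt c] G_def \<delta>_def
    by (rule det_congruence_diagonal)
      (use assms(3) orth X Y Wt metric_sym[of X p Y] metric_sym[of X p W] metric_sym[of Y p W] in
        \<open>simp_all flip: metric_coords[OF _ _ c]\<close>)
  also have "\<dots> = sgn (det G) * (sqrt \<bar>det G\<bar> * \<delta>)\<^sup>2"
    using sgn_mult_abs[of "det G"] by (simp add: power_mult_distrib mult_ac)
  also have "sqrt \<bar>det G\<bar> * \<delta> = g p W W"
    using vol[OF Wt] by (simp add: \<delta>_def)
  also have "sgn (det G) = metric_sign A g p"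
    by (simp add: metric_sign_def G_def c_def)
  finally show ?thesis using W(2) by (simp add: power2_eq_square)
qed

end


section \<open>Covariant differentiation along a curve\<close>

text \<open>In the application, \<open>\<Gamma> j\<close> holds the components of the covariant
  derivative of the \<open>j\<close>-th coordinate field along the curve, and \<open>G\<close> is
  the Gram matrix. The two terms of its derivative are distributed over the two arguments and
  complete \<open>x'\<close> and \<open>y'\<close> to covariant derivatives.\<close>

lemma inner_matrix_product_rule:
  fixes G :: "real \<Rightarrow> real^3^3" and x y :: "real \<Rightarrow> real^3" and \<Gamma> :: "3 \<Rightarrow> real^3"
  assumes x: "(x has_vector_derivative x') (at t)" and y: "(y has_vector_derivative y') (at t)"
    and G: "\<And>i j. ((\<lambda>s. G s $ i $ j) has_real_derivative
        \<Gamma> i \<bullet> (G t *v axis j 1) + axis i 1 \<bullet> (G t *v \<Gamma> j)) (at t)"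
  shows "((\<lambda>s. x s \<bullet> (G s *v y s)) has_real_derivative
      (x' + (\<Sum>j\<in>UNIV. (x t $ j) *\<^sub>R \<Gamma> j)) \<bullet> (G t *v y t) +
      x t \<bullet> (G t *v (y' + (\<Sum>j\<in>UNIV. (y t $ j) *\<^sub>R \<Gamma> j)))) (at t)"
proof -
  have comp: "((\<lambda>s. z s $ i) has_real_derivative z' $ i) (at t)"
    if "(z has_vector_derivative z') (at t)" for z :: "real \<Rightarrow> real^3" and z' i
    using bounded_linear.has_vector_derivative[OF bounded_linear_vec_nth that]
    by (simp add: has_real_derivative_iff_has_vector_derivative)
  let ?G' = "\<lambda>i j. \<Gamma> i \<bullet> (G t *v axis j 1) + axis i 1 \<bullet> (G t *v \<Gamma> j)"
  have "((\<lambda>s. x s \<bullet> (G s *v y s)) has_real_derivative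
      (\<Sum>i\<in>UNIV. \<Sum>j\<in>UNIV. (x' $ i * y t $ j + y' $ j * x t $ i) * G t $ i $ j + ?G' i j * (x t $ i * y t $ j))) (at t)"
    unfolding inner_matrix_expand
    by (intro DERIV_sum DERIV_mult comp x y G[unfolded inner_matrix_expand])
  moreover
  have "?G' i j = (\<Sum>k\<in>UNIV. \<Gamma> i $ k * G t $ k $ j) + (\<Sum>k\<in>UNIV. G t $ i $ k * \<Gamma> j $ k)" for i j
    unfolding inner_axis' matrix_vector_mult_basis
    by (simp add: column_def inner_vec_def matrix_vector_mult_def)
  then have "(\<Sum>i\<in>UNIV. \<Sum>j\<in>UNIV. (x' $ i * y t $ j + y' $ j * x t $ i) * G t $ i $ j + ?G' i j * (x t $ i * y t $ j))
      = (x' + (\<Sum>j\<in>UNIV. (x t $ j) *\<^sub>R \<Gamma> j)) \<bullet> (G t *v y t) +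
        x t \<bullet> (G t *v (y' + (\<Sum>j\<in>UNIV. (y t $ j) *\<^sub>R \<Gamma> j)))"
    by (simp add: inner_matrix_expand sum_3 algebra_simps)
  ultimately show ?thesis by (rule DERIV_cong)
qed

locale curve_in_manifold = pseudo_riemannian_manifold A g
  for A :: "'m::{t2_space,second_countable_topology} chart set" and g :: "'m metric" +
  fixes D :: "'m connection" and I :: "real set" and \<alpha> :: "real \<Rightarrow> 'm"
  assumes levi_civita: "levi_civita A g D"
    and open_I: "open I"
    and smooth_curve: "smooth_curve A I \<alpha>"
begin

section \<open>Curves and fields along them, read in charts\<close>

definition chart_times :: "'m chart \<Rightarrow> real set" where
  "chart_times c = {t\<in>I. \<alpha> t \<in> cdom c}"

text \<open>Smoothness of the components only. Tangency is a separate condition, so that the notion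
  passes directly to covariant derivatives.\<close>

definition smooth_along :: "(real \<Rightarrow> 'm tvec) \<Rightarrow> bool" where
  "smooth_along V \<longleftrightarrow> (\<forall>c\<in>A. smooth_on (chart_times c) (\<lambda>t. V t c))"

lemma smooth_alongD: "smooth_along V \<Longrightarrow> c \<in> A \<Longrightarrow> smooth_on (chart_times c) (\<lambda>t. V t c)"
  unfolding smooth_along_def by (rule bspec)

lemma open_chart_times:
  assumes "c \<in> A"
  shows "open (chart_times c)"
proof -
  have "continuous_on I \<alpha>" using smooth_curve by (simp add: smooth_curve_def)
  from continuous_open_preimage[OF this open_I open_cdom[OF assms]]
  show ?thesis by (simp add: chart_times_def vimage_def Int_def)
qed

lemma smooth_coord_curve: "c \<in> A \<Longrightarrow> smooth_on (chart_times c) (\<lambda>t. coord c (\<alpha> t))"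
  using smooth_curve unfolding smooth_curve_def chart_times_def comp_def by blast

lemma velocity_apply:
  "c \<in> A \<Longrightarrow> t \<in> chart_times c \<Longrightarrow> velocity A \<alpha> t c = vector_derivative (\<lambda>s. coord c (\<alpha> s)) (at t)"
  by (simp add: velocity_def chart_times_def comp_def)

lemma coord_curve_has_vector_derivative:
  assumes "c \<in> A" "t \<in> chart_times c"
  shows "((\<lambda>s. coord c (\<alpha> s)) has_vector_derivative velocity A \<alpha> t c) (at t)"
  unfolding velocity_apply[OF assms]
  by (rule smooth_on_has_vector_derivative[OF smooth_coord_curve[OF assms(1)] assms(2)])

lemma smooth_on_along_curve:
  assumes c: "c \<in> A" and f: "smooth_on (coord c ` cdom c) (\<lambda>x. f (cinv c x))"
  shows "smooth_on (chart_times c) (\<lambda>t. f (\<alpha> t))"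
proof (rule smooth_on_cong[OF open_chart_times[OF c]])
  show "smooth_on (chart_times c) (\<lambda>t. f (cinv c (coord c (\<alpha> t))))"
    by (rule smooth_on_compose[OF f smooth_coord_curve[OF c] open_chart_times[OF c]])
      (auto simp: chart_times_def)
qed (use c in \<open>auto simp: chart_times_def\<close>)

text \<open>The chain rule in the chart \<open>c\<close>, combined with the chart independence of
  \<open>dir_deriv\<close>.\<close>

lemma has_real_derivative_along_curve:
  assumes c: "c \<in> A" "t \<in> chart_times c" and v: "velocity A \<alpha> t \<in> tangent_space A (\<alpha> t)"
    and f: "smooth_on (coord c ` cdom c) (\<lambda>x. f (cinv c x))"
  shows "((\<lambda>s. f (\<alpha> s)) has_real_derivative dir_deriv A (\<alpha> t) (velocity A \<alpha> t) f) (at t)"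
proof -
  let ?v = "velocity A \<alpha> t c"
  have p: "\<alpha> t \<in> cdom c" using c by (simp add: chart_times_def)
  obtain f' where f': "((\<lambda>x. f (cinv c x)) has_derivative f') (at (coord c (\<alpha> t)))"
    using smooth_on_has_derivative[OF f] p by blast
  have "((\<lambda>s. f (cinv c (coord c (\<alpha> s)))) has_derivative (\<lambda>r. f' (r *\<^sub>R ?v))) (at t)"
    using coord_curve_has_vector_derivative[OF c] f' unfolding has_vector_derivative_def
    by (rule has_derivative_compose)
  then have "((\<lambda>s. f (\<alpha> s)) has_derivative (\<lambda>r. f' (r *\<^sub>R ?v))) (at t)"
    by (rule has_derivative_transform_within_open[OF _ open_chart_times[OF c(1)] c(2)])
      (use c in \<open>auto simp: chart_times_def\<close>)
  moreover have "(\<lambda>r. f' (r *\<^sub>R ?v)) = (*) (f' ?v)"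
    using linear_cmul[OF has_derivative_linear[OF f']] by (simp add: fun_eq_iff)
  ultimately show ?thesis
    by (simp add: has_field_derivative_def dir_deriv_chart[OF c(1) p v f'])
qed

text \<open>The transformation law is the chain rule: near \<open>t\<close>, the curve in the chart
  \<open>d\<close> is its image in the chart \<open>c\<close> followed by
  \<open>transition c d\<close>.\<close>

lemma velocity_tangent:
  assumes "t \<in> I"
  shows "velocity A \<alpha> t \<in> tangent_space A (\<alpha> t)"
proof (rule tangent_spaceI)
  fix c d assume c: "c \<in> A" "d \<in> A" "\<alpha> t \<in> cdom c" "\<alpha> t \<in> cdom d"
  have tc: "t \<in> chart_times c" "t \<in> chart_times d"
    using assms c by (auto simp: chart_times_def)
  have "((\<lambda>s. transition c d (coord c (\<alpha> s))) has_derivative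
      (\<lambda>r. jac c d (\<alpha> t) (r *\<^sub>R velocity A \<alpha> t c))) (at t)"
    using coord_curve_has_vector_derivative[OF c(1) tc(1)] transition_has_derivative[OF c]
    unfolding has_vector_derivative_def by (rule has_derivative_compose)
  then have "((\<lambda>s. transition c d (coord c (\<alpha> s))) has_vector_derivative
      jac c d (\<alpha> t) (velocity A \<alpha> t c)) (at t)"
    unfolding has_vector_derivative_def linear_cmul[OF linear_jac[OF c]] .
  then have "((\<lambda>s. coord d (\<alpha> s)) has_vector_derivative jac c d (\<alpha> t) (velocity A \<alpha> t c)) (at t)"
    by (rule has_vector_derivative_transform_within_open[OF _ open_chart_times[OF c(1)] tc(1)])
      (use c in \<open>auto simp: chart_times_def transition_coord\<close>)
  then show "velocity A \<alpha> t d = jac c d (\<alpha> t) (velocity A \<alpha> t c)"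
    unfolding velocity_apply[OF c(2) tc(2)] by (rule vector_derivative_at)
qed (auto simp: velocity_def)

lemma smooth_along_velocity: "smooth_along (velocity A \<alpha>)"
  unfolding smooth_along_def
proof
  fix c assume c: "c \<in> A"
  show "smooth_on (chart_times c) (\<lambda>t. velocity A \<alpha> t c)"
    by (rule smooth_on_cong[OF open_chart_times[OF c] smooth_on_vector_derivative[OF open_chart_times[OF c] smooth_coord_curve[OF c]]])
      (simp add: velocity_apply[OF c])
qed

lemma smooth_along_tscale:
  assumes "smooth_along V"
  shows "smooth_along (\<lambda>t. a \<odot> V t)"
  unfolding smooth_along_def tscale_apply
  by (rule ballI, rule smooth_on_scaleR[OF open_chart_times smooth_on_const[OF open_chart_times]
        smooth_alongD[OF assms]])

lemma smooth_along_tadd: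
  assumes "smooth_along V" "smooth_along W"
  shows "smooth_along (\<lambda>t. V t \<oplus> W t)"
  unfolding smooth_along_def tadd_apply
  by (rule ballI, rule smooth_on_add[OF open_chart_times assms[THEN smooth_alongD]])

lemma smooth_along_cong:
  assumes "smooth_along V" "\<And>t. t \<in> I \<Longrightarrow> V t = W t"
  shows "smooth_along W"
  unfolding smooth_along_def
proof
  fix c assume c: "c \<in> A"
  show "smooth_on (chart_times c) (\<lambda>t. W t c)"
    by (rule smooth_on_cong[OF open_chart_times[OF c] smooth_alongD[OF assms(1) c]])
      (simp add: assms(2) chart_times_def)
qed

section \<open>The Levi-Civita connection on coordinate fields\<close>

lemma affine_connection: "affine_connection A D"
  using levi_civita by (simp add: levi_civita_def)

lemmas smooth_connection =
  affine_connection[unfolded affine_connection_def, THEN conjunct1, rule_format, OF conjI]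

lemmas connection_linear =
  affine_connection[unfolded affine_connection_def, THEN conjunct2, THEN conjunct1, rule_format]

lemmas connection_metric =
  levi_civita[unfolded levi_civita_def, THEN conjunct2, THEN conjunct2, rule_format, OF conjI[OF _ conjI]]

lemma smooth_coord_field: "c \<in> A \<Longrightarrow> smooth_field_on A (cdom c) (coord_field A c i)"
  unfolding coord_field_eq_const_field by (rule smooth_const_field)

lemma coord_field_tangent: "coord_field A c i p \<in> tangent_space A p"
  unfolding coord_field_eq_const_field by (rule const_field_tangent)

text \<open>Tangency is part of the smoothness of a covariant derivative of fields, so
  \<open>v\<close> is first extended to the field with constant components
  \<open>v c\<close>.\<close>

lemma connection_coord_field_tangent:
  assumes c: "c \<in> A" "p \<in> cdom c" and v: "v \<in> tangent_space A p"
  shows "D p v (coord_field A c j) \<in> tangent_space A p"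
proof -
  have "smooth_field_on A (cdom c) (\<lambda>q. D q (const_field A c (v c) q) (coord_field A c j))"
    by (rule smooth_connection[OF smooth_const_field[OF c(1)] smooth_coord_field[OF c(1)]])
  then have "D p (const_field A c (v c) p) (coord_field A c j) \<in> tangent_space A p"
    using c(2) unfolding smooth_field_on_def by blast
  then show ?thesis by (simp only: const_field_components[OF v c])
qed

text \<open>Metric compatibility for two coordinate fields, in the direction of the
  constant-component field that extends the velocity at the single point \<open>p\<close>.\<close>

lemma gram_has_real_derivative:
  assumes c: "c \<in> A" "t \<in> chart_times c"
  defines "p \<equiv> \<alpha> t" and "v \<equiv> velocity A \<alpha> t"
  shows "((\<lambda>s. gram A g c (\<alpha> s) $ i $ j) has_real_derivative
    g p (D p v (coord_field A c i)) (coord_field A c j p) +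
    g p (coord_field A c i p) (D p v (coord_field A c j))) (at t)"
proof -
  have p: "p \<in> cdom c" and v: "v \<in> tangent_space A p"
    using c velocity_tangent by (auto simp: chart_times_def p_def v_def)
  have "smooth_on (coord c ` cdom c) (\<lambda>x. gram A g c (cinv c x) $ i $ j)"
    using c(1) by (rule metric[unfolded pseudo_riemannian_metric_def, THEN conjunct2, THEN conjunct2,
          THEN conjunct2, rule_format])
  from has_real_derivative_along_curve[OF c v[unfolded p_def v_def] this]
  have "((\<lambda>s. gram A g c (\<alpha> s) $ i $ j) has_real_derivative
      dir_deriv A p v (\<lambda>q. g q (coord_field A c i q) (coord_field A c j q))) (at t)"
    by (simp add: gram_def p_def v_def)
  then show ?thesis
    unfolding connection_metric[OF smooth_const_field[OF c(1), of "v c"] smooth_coord_field[OF c(1), of i]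
        smooth_coord_field[OF c(1), of j] p, unfolded const_field_components[OF v c(1) p]] .
qed

section \<open>Calculus of the covariant derivative along the curve\<close>

lemma cov_deriv_apply:
  "c \<in> A \<Longrightarrow> t \<in> chart_times c \<Longrightarrow> cov_deriv A D \<alpha> V t c = vector_derivative (\<lambda>s. V s c) (at t) +
      (\<Sum>j\<in>UNIV. (V t c $ j) *\<^sub>R D (\<alpha> t) (velocity A \<alpha> t) (coord_field A c j) c)"
  by (simp add: cov_deriv_def chart_times_def)

text \<open>The velocity is defined along the curve only, so the connection term is expanded in
  coordinate fields. Its coefficients \<open>?\<Gamma> k j\<close>, the Christoffel symbols as
  vectors, are smooth on the chart domain and are then composed with the curve.\<close>

lemma smooth_along_cov_deriv:
  assumes V: "smooth_along V"
  shows "smooth_along (cov_deriv A D \<alpha> V)"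
  unfolding smooth_along_def
proof
  fix c assume c: "c \<in> A"
  note J = open_chart_times[OF c]
  let ?\<Gamma> = "\<lambda>k j p. D p (coord_field A c k p) (coord_field A c j) c"
  have nth: "smooth_on (chart_times c) (\<lambda>t. W t c $ k)" if "smooth_along W" for W k
    by (rule smooth_on_bounded_linear[OF bounded_linear_vec_nth J smooth_alongD[OF that c]])
  have \<Gamma>: "smooth_on (chart_times c) (\<lambda>t. ?\<Gamma> k j (\<alpha> t))" for k j
  proof (rule smooth_on_along_curve[OF c])
    have "smooth_field_on A (cdom c) (\<lambda>p. D p (coord_field A c k p) (coord_field A c j))"
      by (rule smooth_connection[OF smooth_coord_field[OF c] smooth_coord_field[OF c]])
    then show "smooth_on (coord c ` cdom c) (\<lambda>x. ?\<Gamma> k j (cinv c x))"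
      using c unfolding smooth_field_on_def by fastforce
  qed
  have expand: "D (\<alpha> t) (velocity A \<alpha> t) (coord_field A c j) c
      = (\<Sum>k\<in>UNIV. (velocity A \<alpha> t c $ k) *\<^sub>R ?\<Gamma> k j (\<alpha> t))" if "t \<in> chart_times c" for t j
  proof -
    have t: "t \<in> I" "\<alpha> t \<in> cdom c" using that by (auto simp: chart_times_def)
    show ?thesis
      by (rule tangent_linear_expand[OF _ velocity_tangent[OF t(1)] c t(2)])
        (subst connection_linear[OF smooth_coord_field[OF c] t(2)], assumption, assumption,
          simp only: tadd_apply tscale_apply)
  qed
  show "smooth_on (chart_times c) (\<lambda>t. cov_deriv A D \<alpha> V t c)"
  proof (rule smooth_on_cong[OF J])
    show "smooth_on (chart_times c) (\<lambda>t. vector_derivative (\<lambda>s. V s c) (at t) +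
        (\<Sum>j\<in>UNIV. (V t c $ j) *\<^sub>R (\<Sum>k\<in>UNIV. (velocity A \<alpha> t c $ k) *\<^sub>R ?\<Gamma> k j (\<alpha> t))))"
      by (intro smooth_on_add smooth_on_sum smooth_on_scaleR J finite nth V smooth_along_velocity \<Gamma>
          smooth_on_vector_derivative smooth_alongD[OF V c])
  qed (simp add: cov_deriv_apply[OF c] expand)
qed

text \<open>Since \<open>I\<close> is open, the derivative at \<open>t\<close> sees only values on
  \<open>I\<close>; the Frenet and Cartan identities, which hold on \<open>I\<close> alone, may thus
  be differentiated.\<close>

lemma cov_deriv_cong:
  assumes t: "t \<in> I" and eq: "\<And>s. s \<in> I \<Longrightarrow> V s = W s"
  shows "cov_deriv A D \<alpha> V t = cov_deriv A D \<alpha> W t"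
proof -
  have "vector_derivative (\<lambda>s. V s c) (at t) = vector_derivative (\<lambda>s. W s c) (at t)" for c
    by (rule vector_derivative_cong_eq)
      (use eq in \<open>auto intro!: eventually_nhds_in_open[OF open_I t, THEN eventually_mono]\<close>)
  then show ?thesis by (simp add: cov_deriv_def eq[OF t] cong: if_cong)
qed

lemma cov_deriv_eqI:
  assumes "t \<in> I"
    and "\<And>c. c \<in> A \<Longrightarrow> t \<in> chart_times c \<Longrightarrow> cov_deriv A D \<alpha> V t c = X c"
    and "\<And>c. c \<notin> A \<or> \<alpha> t \<notin> cdom c \<Longrightarrow> X c = 0"
  shows "cov_deriv A D \<alpha> V t = X"
proof
  fix c
  show "cov_deriv A D \<alpha> V t c = X c"
  proof (cases "c \<in> A \<and> \<alpha> t \<in> cdom c")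
    case True
    then show ?thesis using assms(1,2) by (simp add: chart_times_def)
  next
    case False
    then show ?thesis using assms(3) by (auto simp: cov_deriv_def)
  qed
qed

lemma has_vector_derivative_along:
  assumes "smooth_along V" "c \<in> A" "t \<in> chart_times c"
  shows "((\<lambda>s. V s c) has_vector_derivative vector_derivative (\<lambda>s. V s c) (at t)) (at t)"
  by (rule smooth_on_has_vector_derivative[OF smooth_alongD[OF assms(1,2)] assms(3)])

lemma cov_deriv_tscale:
  assumes V: "smooth_along V" and "t \<in> I"
  shows "cov_deriv A D \<alpha> (\<lambda>s. a \<odot> V s) t = a \<odot> cov_deriv A D \<alpha> V t"
proof (rule cov_deriv_eqI[OF assms(2)])
  fix c assume c: "c \<in> A" "t \<in> chart_times c"
  have "vector_derivative (\<lambda>s. a *\<^sub>R V s c) (at t) = a *\<^sub>R vector_derivative (\<lambda>s. V s c) (at t)"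
    by (rule vector_derivative_at, rule bounded_linear.has_vector_derivative[OF bounded_linear_scaleR_right
          has_vector_derivative_along[OF V c]])
  then show "cov_deriv A D \<alpha> (\<lambda>s. a \<odot> V s) t c = (a \<odot> cov_deriv A D \<alpha> V t) c"
    by (simp add: cov_deriv_apply[OF c] scaleR_add_right scaleR_sum_right)
qed (auto simp: cov_deriv_def)

lemma cov_deriv_tadd:
  assumes V: "smooth_along V" and W: "smooth_along W" and "t \<in> I"
  shows "cov_deriv A D \<alpha> (\<lambda>s. V s \<oplus> W s) t = cov_deriv A D \<alpha> V t \<oplus> cov_deriv A D \<alpha> W t"
proof (rule cov_deriv_eqI[OF assms(3)])
  fix c assume c: "c \<in> A" "t \<in> chart_times c"
  have "vector_derivative (\<lambda>s. V s c + W s c) (at t)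
      = vector_derivative (\<lambda>s. V s c) (at t) + vector_derivative (\<lambda>s. W s c) (at t)"
    by (rule vector_derivative_at, rule has_vector_derivative_add[OF
          has_vector_derivative_along[OF V c] has_vector_derivative_along[OF W c]])
  then show "cov_deriv A D \<alpha> (\<lambda>s. V s \<oplus> W s) t c = (cov_deriv A D \<alpha> V t \<oplus> cov_deriv A D \<alpha> W t) c"
    by (simp add: cov_deriv_apply[OF c] scaleR_add_left sum.distrib)
qed (auto simp: cov_deriv_def)

text \<open>Metric compatibility for fields along the curve: the product rule for
  \<open>x \<bullet> (G *v y)\<close>, with the derivative of the Gram matrix taken from
  \<open>gram_has_real_derivative\<close>.\<close>

lemma metric_has_real_derivative:
  assumes V: "smooth_along V" "\<And>s. s \<in> I \<Longrightarrow> V s \<in> tangent_space A (\<alpha> s)"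
    and W: "smooth_along W" "\<And>s. s \<in> I \<Longrightarrow> W s \<in> tangent_space A (\<alpha> s)"
    and t: "t \<in> I" "c \<in> A" "\<alpha> t \<in> cdom c"
  defines "G \<equiv> gram A g c (\<alpha> t)"
  shows "((\<lambda>s. g (\<alpha> s) (V s) (W s)) has_real_derivative
    cov_deriv A D \<alpha> V t c \<bullet> (G *v W t c) + V t c \<bullet> (G *v cov_deriv A D \<alpha> W t c)) (at t)"
proof -
  have c: "c \<in> A" "t \<in> chart_times c" using t by (auto simp: chart_times_def)
  let ?\<Gamma> = "\<lambda>j. D (\<alpha> t) (velocity A \<alpha> t) (coord_field A c j)"
  have \<Gamma>: "?\<Gamma> j \<in> tangent_space A (\<alpha> t)" for j
    by (rule connection_coord_field_tangent[OF t(2,3) velocity_tangent[OF t(1)]])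
  have axis: "coord_field A c j (\<alpha> t) c = axis j 1" for j
    by (simp add: coord_field_eq_const_field t)
  have G: "((\<lambda>s. gram A g c (\<alpha> s) $ i $ j) has_real_derivative
      ?\<Gamma> i c \<bullet> (gram A g c (\<alpha> t) *v axis j 1) + axis i 1 \<bullet> (gram A g c (\<alpha> t) *v ?\<Gamma> j c)) (at t)" for i j
    using gram_has_real_derivative[OF c, of i j]
    unfolding metric_coords[OF \<Gamma> coord_field_tangent t(2,3)]
      metric_coords[OF coord_field_tangent \<Gamma> t(2,3)] axis .
  from inner_matrix_product_rule[OF has_vector_derivative_along[OF V(1) c]
      has_vector_derivative_along[OF W(1) c] this]
  have "((\<lambda>s. V s c \<bullet> (gram A g c (\<alpha> s) *v W s c)) has_real_derivative
      cov_deriv A D \<alpha> V t c \<bullet> (G *v W t c) + V t c \<bullet> (G *v cov_deriv A D \<alpha> W t c)) (at t)"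
    unfolding cov_deriv_apply[OF c] G_def .
  then show ?thesis
    by (rule has_field_derivative_transform_within_open[OF _ open_chart_times[OF c(1)] c(2)])
      (use t V(2) W(2) in \<open>auto simp: chart_times_def metric_coords\<close>)
qed

end


section \<open>The Frenet frame of a curve of constant curvature and torsion\<close>

context pseudo_riemannian_manifold
begin

lemma metric_tscale_left:
  assumes "u \<in> tangent_space A p" "v \<in> tangent_space A p"
  shows "g p (a \<odot> u) v = a * g p u v"
proof -
  have "a \<odot> u \<oplus> 0 \<odot> u = a \<odot> u" by (intro ext) simp
  from metric_linear_left[OF assms(1,1,2), of a 0, unfolded this] show ?thesis by simp
qed

lemma metric_tscale_right:
  assumes "u \<in> tangent_space A p" "v \<in> tangent_space A p"
  shows "g p u (a \<odot> v) = a * g p u v"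
  using metric_tscale_left[OF assms(2,1), of a] metric_sym[OF assms(1)] assms(2) tangent_tscale by metis

lemma metric_sign_square: "(metric_sign A g p)\<^sup>2 = 1"
  using gram_nondegenerate[OF chart_at, of p]
  by (simp add: metric_sign_def power2_eq_square sgn_if)

text \<open>The volume form becomes a determinant with two equal rows.\<close>

lemma metric_cross_product_left:
  assumes "X \<in> tangent_space A p" "Y \<in> tangent_space A p"
  shows "g p (cross_product A g p X Y) X = 0" "g p (cross_product A g p X Y) Y = 0"
  using assms by (simp_all add: metric_cross_product volume_form_def Let_def det_3 vector_3)

end

text \<open>Here \<kappa> and \<tau> are numbers, so that they can be moved through covariant
  derivatives; the theorem instantiates them with the constant values of the given
  functions.\<close>

locale constant_frenet_curve = curve_in_manifold A g D I \<alpha>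
  for A :: "'m::{t2_space,second_countable_topology} chart set" and g :: "'m metric"
    and D :: "'m connection" and I :: "real set" and \<alpha> :: "real \<Rightarrow> 'm" +
  fixes \<epsilon>\<^sub>1 \<kappa> \<tau> :: real and N :: "real \<Rightarrow> 'm tvec"
  assumes interval: "is_interval I"
    and nonempty: "I \<noteq> {}"
    and arc_length: "arc_length_parametrized A g I \<alpha> \<epsilon>\<^sub>1"
    and accel_non_null: "t \<in> I \<Longrightarrow> g (\<alpha> t) (accel A D \<alpha> t) (accel A D \<alpha> t) \<noteq> 0"
    and nondegenerate: "nondegenerate_curve A g D I \<alpha>"
    and curvature: "frenet_curvature A g D I \<alpha> (\<lambda>_. \<kappa>) N"
    and torsion: "frenet_torsion A g D I \<alpha> \<epsilon>\<^sub>1 (\<lambda>_. \<kappa>) N (\<lambda>_. \<tau>)"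
begin

abbreviation "T \<equiv> velocity A \<alpha>"
abbreviation "\<epsilon>\<^sub>2 \<equiv> eps2 A g D \<alpha>"
abbreviation "\<epsilon>\<^sub>3 \<equiv> eps3 A g D \<alpha> \<epsilon>\<^sub>1"
abbreviation "nabla \<equiv> cov_deriv A D \<alpha>"
abbreviation "W t \<equiv> cross_product A g (\<alpha> t) (T t) (N t)"

section \<open>Signs, tangency and orthogonality in the Frenet frame\<close>

lemma eps1_square: "\<epsilon>\<^sub>1\<^sup>2 = 1"
  using arc_length by (auto simp: arc_length_parametrized_def)

lemma metric_T_T: "t \<in> I \<Longrightarrow> g (\<alpha> t) (T t) (T t) = \<epsilon>\<^sub>1"
  using arc_length by (simp add: arc_length_parametrized_def)

lemma eps2_square: "t \<in> I \<Longrightarrow> (\<epsilon>\<^sub>2 t)\<^sup>2 = 1"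
  using accel_non_null by (simp add: eps2_def power2_eq_square sgn_if)

lemma eps3_square: "t \<in> I \<Longrightarrow> (\<epsilon>\<^sub>3 t)\<^sup>2 = 1"
  by (simp add: eps3_def power_mult_distrib metric_sign_square eps1_square eps2_square)

lemma N_tangent: "t \<in> I \<Longrightarrow> N t \<in> tangent_space A (\<alpha> t)"
  and curvature_pos: "t \<in> I \<Longrightarrow> \<kappa> > 0"
  and accel_eq: "t \<in> I \<Longrightarrow> accel A D \<alpha> t = (\<epsilon>\<^sub>2 t * \<kappa>) \<odot> N t"
  and metric_N_N: "t \<in> I \<Longrightarrow> g (\<alpha> t) (N t) (N t) = \<epsilon>\<^sub>2 t"
  using curvature unfolding frenet_curvature_def by blast+

lemma W_tangent: "t \<in> I \<Longrightarrow> W t \<in> tangent_space A (\<alpha> t)"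
  by (rule cross_product_tangent[OF velocity_tangent N_tangent])

lemma accel_tangent: "t \<in> I \<Longrightarrow> accel A D \<alpha> t \<in> tangent_space A (\<alpha> t)"
  using accel_eq N_tangent tangent_tscale by metis

lemma metric_W_T: "t \<in> I \<Longrightarrow> g (\<alpha> t) (W t) (T t) = 0"
  and metric_W_N: "t \<in> I \<Longrightarrow> g (\<alpha> t) (W t) (N t) = 0"
  by (rule metric_cross_product_left[OF velocity_tangent N_tangent]; assumption)+

section \<open>Constancy of \<open>\<epsilon>\<^sub>2\<close> and the covariant derivative of
  N\<close>

lemma smooth_along_accel: "smooth_along (accel A D \<alpha>)"
  unfolding accel_def by (rule smooth_along_cov_deriv[OF smooth_along_velocity])

lemma metric_continuous_along:
  assumes V: "smooth_along V" "\<And>s. s \<in> I \<Longrightarrow> V s \<in> tangent_space A (\<alpha> s)"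
  shows "continuous_on I (\<lambda>t. g (\<alpha> t) (V t) (V t))"
  by (intro continuous_at_imp_continuous_on ballI)
    (rule DERIV_isCont[OF metric_has_real_derivative[OF V V _ chart_at]])

text \<open>A continuous function with finitely many values on a connected set is constant.\<close>

lemma sign_constant_on:
  assumes "continuous_on I f" "\<And>t. t \<in> I \<Longrightarrow> (f t)\<^sup>2 = (1::real)"
  shows "f constant_on I"
proof (rule continuous_finite_range_constant[OF _ assms(1)])
  show "connected I" using interval by (rule is_interval_connected)
  have "f ` I \<subseteq> {1, -1}" using assms(2) by (auto simp: power2_eq_1_iff)
  then show "finite (f ` I)" by (rule finite_subset) simp
qed

lemma eps2_constant_on: "\<epsilon>\<^sub>2 constant_on I"
proof (rule sign_constant_on[OF _ eps2_square])
  \<comment> \<open>By \<open>accel_eq\<close> the numerator is \<open>(\<epsilon>\<^sub>2 t *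
    \<kappa>)\<^sup>2 * \<epsilon>\<^sub>2 t\<close>. This presents the sign as a continuous
    function.\<close>
  have "g (\<alpha> t) (accel A D \<alpha> t) (accel A D \<alpha> t) / \<kappa>\<^sup>2 = \<epsilon>\<^sub>2 t" if t: "t \<in> I" for t
    unfolding accel_eq[OF t] metric_tscale_left[OF N_tangent[OF t] tangent_tscale[OF N_tangent[OF t]]]
      metric_tscale_right[OF N_tangent[OF t] N_tangent[OF t]] metric_N_N[OF t]
    using eps2_square[OF t] curvature_pos[OF t] by (simp add: power2_eq_square)
  moreover have "continuous_on I (\<lambda>t. g (\<alpha> t) (accel A D \<alpha> t) (accel A D \<alpha> t) / \<kappa>\<^sup>2)"
    unfolding divide_inverse
    by (rule continuous_on_mult_right[OF metric_continuous_along[OF smooth_along_accel accel_tangent]])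
  ultimately show "continuous_on I \<epsilon>\<^sub>2" using continuous_on_cong by (metis (no_types, lifting))
qed

lemma eps2_eq: "s \<in> I \<Longrightarrow> t \<in> I \<Longrightarrow> \<epsilon>\<^sub>2 s = \<epsilon>\<^sub>2 t"
  using eps2_constant_on by (auto simp: constant_on_def)

lemma accel_const:
  assumes "t \<in> I" "s \<in> I"
  shows "accel A D \<alpha> s = (\<epsilon>\<^sub>2 t * \<kappa>) \<odot> N s"
  unfolding accel_eq[OF assms(2)] eps2_eq[OF assms] ..

text \<open>N is a constant multiple of the acceleration: \<kappa> is a number, and
  \<open>\<epsilon>\<^sub>2\<close> may be frozen at one time.\<close>

lemma smooth_along_N: "smooth_along N"
proof -
  obtain t where t: "t \<in> I" using nonempty by blast
  have "\<epsilon>\<^sub>2 t * \<kappa> \<noteq> 0" using eps2_square[OF t] curvature_pos[OF t] by auto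
  then have "(1 / (\<epsilon>\<^sub>2 t * \<kappa>)) \<odot> accel A D \<alpha> s = N s" if "s \<in> I" for s
    unfolding accel_const[OF t that] tscale_tscale by (intro ext) simp
  then show ?thesis
    by (rule smooth_along_cong[OF smooth_along_tscale[OF smooth_along_accel]])
qed

lemma nabla_accel:
  assumes "t \<in> I"
  shows "nabla (accel A D \<alpha>) t = (\<epsilon>\<^sub>2 t * \<kappa>) \<odot> nabla N t"
  using cov_deriv_cong[OF assms, of "accel A D \<alpha>" "\<lambda>s. (\<epsilon>\<^sub>2 t * \<kappa>) \<odot> N s", OF accel_const[OF assms]]
    cov_deriv_tscale[OF smooth_along_N assms] by metis

text \<open>The torsion equation and the definition of the binormal each contribute a factor
  \<open>\<epsilon>\<^sub>3 t\<close>, and the two cancel.\<close>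

lemma nabla_N:
  assumes "t \<in> I"
  shows "nabla N t = (- \<epsilon>\<^sub>1 * \<kappa>) \<odot> T t \<oplus> \<tau> \<odot> W t"
proof -
  have "nabla N t = (- \<epsilon>\<^sub>1 * \<kappa>) \<odot> T t \<oplus> (\<epsilon>\<^sub>3 t * \<tau>) \<odot> \<epsilon>\<^sub>3 t \<odot> W t"
    using torsion assms unfolding frenet_torsion_def binormal_def by blast
  moreover have "\<epsilon>\<^sub>3 t * \<tau> * \<epsilon>\<^sub>3 t = \<tau>"
    using eps3_square[OF assms] by (simp add: power2_eq_square)
  ultimately show ?thesis by (simp only: tscale_tscale)
qed

text \<open>Differentiating the constant g(T,T) shows that T is orthogonal to its covariant
  derivative, a nonzero multiple of N. That multiple is a tangent vector, so the products in
  coordinates can be turned back into values of the metric.\<close>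

lemma metric_T_N:
  assumes t: "t \<in> I"
  shows "g (\<alpha> t) (T t) (N t) = 0"
proof -
  have T: "smooth_along T" "\<And>s. s \<in> I \<Longrightarrow> T s \<in> tangent_space A (\<alpha> s)"
    by (rule smooth_along_velocity) (rule velocity_tangent)
  have "((\<lambda>s. g (\<alpha> s) (T s) (T s)) has_real_derivative 0) (at t)"
    by (rule has_field_derivative_transform_within_open[OF DERIV_const open_I t]) (simp add: metric_T_T)
  from DERIV_unique[OF this metric_has_real_derivative[OF T T t chart_at], folded accel_def]
  have "g (\<alpha> t) (accel A D \<alpha> t) (T t) + g (\<alpha> t) (T t) (accel A D \<alpha> t) = 0"
    unfolding metric_coords[OF accel_tangent[OF t] T(2)[OF t] chart_at]
      metric_coords[OF T(2)[OF t] accel_tangent[OF t] chart_at] by (rule sym)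
  then have "g (\<alpha> t) (T t) (accel A D \<alpha> t) = 0"
    using metric_sym[OF accel_tangent[OF t] T(2)[OF t]] by simp
  then show ?thesis
    unfolding accel_eq[OF t] metric_tscale_right[OF T(2)[OF t] N_tangent[OF t]]
    using eps2_square[OF t] curvature_pos[OF t] by auto
qed

lemma affine_density_eq:
  assumes t: "t \<in> I"
  shows "affine_density A g D \<alpha> t = \<kappa>\<^sup>2 * \<tau> * g (\<alpha> t) (W t) (W t)"
proof -
  \<comment> \<open>The T-component of the third argument repeats the first row and drops out; the
    factor \<open>\<epsilon>\<^sub>2 t * \<kappa>\<close>, which occurs in the second and third
    arguments, appears squared.\<close>
  have lin: "volume_form A g p X (a \<odot> Y) (a \<odot> (b \<odot> X \<oplus> c \<odot> Z)) = a\<^sup>2 * c * volume_form A g p X Y Z"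
    for p X Y Z a b c
    by (simp add: volume_form_def Let_def det_3 vector_3 algebra_simps power2_eq_square)
  have "affine_density A g D \<alpha> t = (\<epsilon>\<^sub>2 t * \<kappa>)\<^sup>2 * \<tau> * volume_form A g (\<alpha> t) (T t) (N t) (W t)"
    unfolding affine_density_def nabla_accel[OF t] nabla_N[OF t] accel_eq[OF t] lin ..
  then show ?thesis
    using metric_cross_product[OF velocity_tangent[OF t] N_tangent[OF t] W_tangent[OF t]] eps2_square[OF t]
    by (simp add: power_mult_distrib)
qed

text \<open>Non-degeneracy makes every factor of the affine density nonzero. The Gram determinant
  then gives \<open>\<epsilon>\<^sub>1 * \<epsilon>\<^sub>2 t\<close> as \<omega> g(W,W), and
  multiplication by \<omega> isolates g(W,W).\<close>

lemma
  assumes t: "t \<in> I"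
  shows torsion_nonzero: "\<tau> \<noteq> 0" and metric_W_W: "g (\<alpha> t) (W t) (W t) = \<epsilon>\<^sub>3 t"
proof -
  have nz: "\<tau> \<noteq> 0" "g (\<alpha> t) (W t) (W t) \<noteq> 0"
    using nondegenerate t affine_density_eq[OF t] by (auto simp: nondegenerate_curve_def)
  then show "\<tau> \<noteq> 0" by simp
  have "\<epsilon>\<^sub>1 * \<epsilon>\<^sub>2 t = metric_sign A g (\<alpha> t) * g (\<alpha> t) (W t) (W t)"
    using metric_cross_product_self[OF velocity_tangent[OF t] N_tangent[OF t] metric_T_N[OF t] refl nz(2)]
    unfolding metric_T_T[OF t] metric_N_N[OF t] .
  then have "\<epsilon>\<^sub>3 t = (metric_sign A g (\<alpha> t))\<^sup>2 * g (\<alpha> t) (W t) (W t)"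
    by (simp add: eps3_def power2_eq_square mult.assoc)
  then show "g (\<alpha> t) (W t) (W t) = \<epsilon>\<^sub>3 t" by (simp add: metric_sign_square)
qed

text \<open>W is obtained by solving the Frenet equation for the derivative of N, with division by
  \<tau>.\<close>

lemma smooth_along_W: "smooth_along W"
proof (rule smooth_along_cong)
  show "smooth_along (\<lambda>s. (1 / \<tau>) \<odot> (nabla N s \<oplus> (\<epsilon>\<^sub>1 * \<kappa>) \<odot> T s))"
    by (rule smooth_along_tscale[OF smooth_along_tadd[OF
            smooth_along_cov_deriv[OF smooth_along_N] smooth_along_tscale[OF smooth_along_velocity]]])
  show "(1 / \<tau>) \<odot> (nabla N s \<oplus> (\<epsilon>\<^sub>1 * \<kappa>) \<odot> T s) = W s" if "s \<in> I" for s
    unfolding nabla_N[OF that] using torsion_nonzero[OF that] by (intro ext) simp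
qed

text \<open>The sign equals g(W,W), which is continuous along the curve.\<close>

lemma eps3_constant_on: "\<epsilon>\<^sub>3 constant_on I"
proof (rule sign_constant_on[OF _ eps3_square])
  show "continuous_on I \<epsilon>\<^sub>3"
    using metric_continuous_along[OF smooth_along_W W_tangent] metric_W_W
    by (simp cong: continuous_on_cong)
qed

text \<open>Differentiating g(W,T) = 0 and g(W,N) = 0 moves the derivative onto T and N, where the
  Frenet equations are known: the first is a multiple of N, and the second meets W only in its
  \<tau>-term.\<close>

lemma
  assumes t: "t \<in> I"
  defines "c \<equiv> chart_at A (\<alpha> t)"
  defines "G \<equiv> gram A g c (\<alpha> t)"
  shows nabla_W_T: "nabla W t c \<bullet> (G *v T t c) = 0"
    and nabla_W_N: "nabla W t c \<bullet> (G *v N t c) = - \<epsilon>\<^sub>3 t * \<tau>"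
proof -
  note c = chart_at[of "\<alpha> t", folded c_def]
  note tan = velocity_tangent[OF t] N_tangent[OF t] W_tangent[OF t]
  have W: "smooth_along W" "\<And>s. s \<in> I \<Longrightarrow> W s \<in> tangent_space A (\<alpha> s)"
    by (rule smooth_along_W) (rule W_tangent)
  have inner: "W t c \<bullet> (G *v T t c) = 0" "W t c \<bullet> (G *v N t c) = 0" "W t c \<bullet> (G *v W t c) = \<epsilon>\<^sub>3 t"
    using metric_W_T[OF t] metric_W_N[OF t] metric_W_W[OF t]
    unfolding metric_coords[OF tan(3) tan(1) c] metric_coords[OF tan(3) tan(2) c]
      metric_coords[OF tan(3) tan(3) c] G_def by auto
  have "((\<lambda>s. g (\<alpha> s) (W s) (T s)) has_real_derivative 0) (at t)"
    by (rule has_field_derivative_transform_within_open[OF DERIV_const open_I t]) (simp add: metric_W_T)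
  from DERIV_unique[OF this metric_has_real_derivative[OF W smooth_along_velocity velocity_tangent t c]]
  have "nabla W t c \<bullet> (G *v T t c) + W t c \<bullet> (G *v accel A D \<alpha> t c) = 0"
    by (simp add: G_def accel_def)
  then show "nabla W t c \<bullet> (G *v T t c) = 0"
    by (simp add: accel_eq[OF t] inner matrix_vector_mult_scaleR)
  have "((\<lambda>s. g (\<alpha> s) (W s) (N s)) has_real_derivative 0) (at t)"
    by (rule has_field_derivative_transform_within_open[OF DERIV_const open_I t]) (simp add: metric_W_N)
  from DERIV_unique[OF this metric_has_real_derivative[OF W smooth_along_N N_tangent t c]]
  have "nabla W t c \<bullet> (G *v N t c) + W t c \<bullet> (G *v nabla N t c) = 0"
    by (simp add: G_def)
  then show "nabla W t c \<bullet> (G *v N t c) = - \<epsilon>\<^sub>3 t * \<tau>"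
    by (simp add: nabla_N[OF t] inner matrix_vector_mult_scaleR matrix_vector_mult_diff_distrib
        inner_diff_right eq_neg_iff_add_eq_0 mult.commute)
qed

section \<open>The Cartan frame\<close>

text \<open>The common value of \<open>cartan_phi\<close> on \<open>I\<close>: the affine density is
  \<open>\<epsilon>\<^sub>3 t * \<kappa>\<^sup>2 * \<tau>\<close>, and its sign disappears in the
  absolute value.\<close>

definition \<phi> :: real where "\<phi> = (\<kappa>\<^sup>2 * \<bar>\<tau>\<bar>) powr (- 1 / 6)"

lemma cartan_phi_eq:
  assumes "t \<in> I"
  shows "cartan_phi A g D \<alpha> t = \<phi>"
proof -
  have "\<bar>\<epsilon>\<^sub>3 t\<bar> = 1" using eps3_square[OF assms] by (auto simp: power2_eq_1_iff)
  then show ?thesis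
    by (simp add: cartan_phi_def affine_density_eq[OF assms] metric_W_W[OF assms] \<phi>_def abs_mult)
qed

lemma phi_pos: "t \<in> I \<Longrightarrow> \<phi> > 0"
  using curvature_pos[of t] torsion_nonzero[of t] by (simp add: \<phi>_def)

lemma phi_square:
  assumes "t \<in> I"
  shows "\<phi>\<^sup>2 = 1 / (\<kappa> powr (2/3) * \<bar>\<tau>\<bar> powr (1/3))"
proof -
  have "\<phi>\<^sup>2 = (\<kappa>\<^sup>2 * \<bar>\<tau>\<bar>) powr (- (1/3))"
    by (simp add: \<phi>_def power2_eq_square flip: powr_add)
  also have "\<dots> = 1 / ((\<kappa> powr 2) powr (1/3) * \<bar>\<tau>\<bar> powr (1/3))"
    using curvature_pos[OF assms] by (simp add: powr_minus_divide powr_mult powr_numeral)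
  finally show ?thesis by (simp add: powr_powr)
qed

lemma cartan_e1_eq: "t \<in> I \<Longrightarrow> cartan_e1 A g D \<alpha> t = \<phi> \<odot> T t"
  by (simp only: cartan_e1_def cartan_phi_eq)

text \<open>As \<phi> is constant, each step in the Cartan frame multiplies by \<phi> without
  creating a derivative of it.\<close>

lemma cartan_deriv_tscale:
  assumes t: "t \<in> I" and V: "smooth_along V" and eq: "\<And>s. s \<in> I \<Longrightarrow> X s = a \<odot> V s"
  shows "cartan_deriv A g D \<alpha> X t = (\<phi> * a) \<odot> nabla V t"
proof -
  have "nabla X t = nabla (\<lambda>s. a \<odot> V s) t"
    by (rule cov_deriv_cong[OF t eq])
  then show ?thesis
    by (simp only: cartan_deriv_def cartan_phi_eq[OF t] cov_deriv_tscale[OF V t] tscale_tscale)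
qed

lemma cartan_e2_eq: "t \<in> I \<Longrightarrow> cartan_e2 A g D \<alpha> t = \<phi>\<^sup>2 \<odot> accel A D \<alpha> t"
  unfolding cartan_e2_def power2_eq_square accel_def
  by (rule cartan_deriv_tscale[OF _ smooth_along_velocity cartan_e1_eq])

text \<open>The sign is evaluated at a fixed \<open>t\<close> while \<open>s\<close> varies, so that
  the coefficient is a constant in the next differentiation.\<close>

lemma cartan_e3_eq:
  assumes t: "t \<in> I" and "s \<in> I"
  shows "cartan_e3 A g D \<alpha> s = (\<phi> ^ 3 * \<epsilon>\<^sub>2 t * \<kappa>) \<odot> ((- \<epsilon>\<^sub>1 * \<kappa>) \<odot> T s \<oplus> \<tau> \<odot> W s)"
proof -
  have "cartan_e3 A g D \<alpha> s = (\<phi> * \<phi>\<^sup>2) \<odot> nabla (accel A D \<alpha>) s"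
    unfolding cartan_e3_def by (rule cartan_deriv_tscale[OF assms(2) smooth_along_accel cartan_e2_eq])
  then show ?thesis
    unfolding nabla_accel[OF assms(2)] nabla_N[OF assms(2)] eps2_eq[OF assms(2,1)]
    by (simp only: tscale_tscale power2_eq_square power3_eq_cube mult.assoc)
qed

lemma cartan_deriv_e3:
  assumes t: "t \<in> I"
  shows "cartan_deriv A g D \<alpha> (cartan_e3 A g D \<alpha>) t =
    (\<phi> * (\<phi> ^ 3 * \<epsilon>\<^sub>2 t * \<kappa>)) \<odot> ((- \<epsilon>\<^sub>1 * \<kappa>) \<odot> accel A D \<alpha> t \<oplus> \<tau> \<odot> nabla W t)"
proof -
  note smooth = smooth_along_tscale[OF smooth_along_velocity] smooth_along_tscale[OF smooth_along_W]
  have "cartan_deriv A g D \<alpha> (cartan_e3 A g D \<alpha>) t =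
      (\<phi> * (\<phi> ^ 3 * \<epsilon>\<^sub>2 t * \<kappa>)) \<odot> nabla (\<lambda>s. (- \<epsilon>\<^sub>1 * \<kappa>) \<odot> T s \<oplus> \<tau> \<odot> W s) t"
    by (rule cartan_deriv_tscale[OF t smooth_along_tadd[OF smooth] cartan_e3_eq[OF t]])
  then show ?thesis
    unfolding cov_deriv_tadd[OF smooth t] cov_deriv_tscale[OF smooth_along_velocity t]
      cov_deriv_tscale[OF smooth_along_W t] accel_def .
qed

text \<open>The defining equation is paired with T and with N. These two products of the derivative
  of W are known, and on the right they separate the two curvatures because T and N are orthogonal
  and non-null.\<close>

lemma equi_affine_curvatures_eq:
  assumes "equi_affine_curvatures A g D I \<alpha> k\<^sub>1 k\<^sub>2" and t: "t \<in> I"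
  shows "k\<^sub>1 t = 0"
    and "k\<^sub>2 t = - (\<epsilon>\<^sub>2 t * (\<epsilon>\<^sub>1 * \<kappa>\<^sup>2 + \<epsilon>\<^sub>3 t * \<tau>\<^sup>2)) / (\<kappa> powr (2/3) * \<bar>\<tau>\<bar> powr (1/3))"
proof -
  define c where "c = chart_at A (\<alpha> t)"
  define G where "G = gram A g c (\<alpha> t)"
  note c = chart_at[of "\<alpha> t", folded c_def]
  note tan = velocity_tangent[OF t] N_tangent[OF t]
  have inner: "T t c \<bullet> (G *v T t c) = \<epsilon>\<^sub>1" "N t c \<bullet> (G *v N t c) = \<epsilon>\<^sub>2 t"
    "N t c \<bullet> (G *v T t c) = 0" "T t c \<bullet> (G *v N t c) = 0"
    using metric_T_T[OF t] metric_N_N[OF t] metric_T_N[OF t] metric_sym[OF tan]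
    unfolding metric_coords[OF tan(1,1) c] metric_coords[OF tan(2,2) c] metric_coords[OF tan(1,2) c]
      metric_coords[OF tan(2,1) c] G_def by auto
  have "cartan_deriv A g D \<alpha> (cartan_e3 A g D \<alpha>) t =
      k\<^sub>1 t \<odot> cartan_e1 A g D \<alpha> t \<oplus> k\<^sub>2 t \<odot> cartan_e2 A g D \<alpha> t"
    using assms by (simp add: equi_affine_curvatures_def)
  then have "((\<phi> * (\<phi> ^ 3 * \<epsilon>\<^sub>2 t * \<kappa>)) \<odot> ((- \<epsilon>\<^sub>1 * \<kappa>) \<odot> (\<epsilon>\<^sub>2 t * \<kappa>) \<odot> N t \<oplus> \<tau> \<odot> nabla W t)) c
      = (k\<^sub>1 t \<odot> \<phi> \<odot> T t \<oplus> k\<^sub>2 t \<odot> \<phi>\<^sup>2 \<odot> (\<epsilon>\<^sub>2 t * \<kappa>) \<odot> N t) c"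
    unfolding cartan_deriv_e3[OF t] cartan_e1_eq[OF t] cartan_e2_eq[OF t] accel_eq[OF t] by (rule fun_cong)
  then have eq: "(\<phi> ^ 4 * \<epsilon>\<^sub>2 t * \<kappa>) *\<^sub>R ((- \<epsilon>\<^sub>1 * \<epsilon>\<^sub>2 t * \<kappa>\<^sup>2) *\<^sub>R N t c + \<tau> *\<^sub>R nabla W t c)
      = (k\<^sub>1 t * \<phi>) *\<^sub>R T t c + (k\<^sub>2 t * \<phi>\<^sup>2 * \<epsilon>\<^sub>2 t * \<kappa>) *\<^sub>R N t c"
    by (simp add: power2_eq_square power4_eq_xxxx power3_eq_cube mult_ac)
  note W = nabla_W_T[OF t, folded c_def, folded G_def] nabla_W_N[OF t, folded c_def, folded G_def]
  \<comment> \<open>Paired with T, the left side vanishes: N and the derivative of W both have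
    product 0 with T.\<close>
  have "k\<^sub>1 t * \<phi> * \<epsilon>\<^sub>1 = 0"
    using arg_cong[OF eq, of "\<lambda>x. x \<bullet> (G *v T t c)"] by (simp add: inner_add_left inner_diff_left inner W)
  then show "k\<^sub>1 t = 0" using phi_pos[OF t] eps1_square by auto
  have "(\<phi> ^ 4 * \<epsilon>\<^sub>2 t * \<kappa>) * ((- \<epsilon>\<^sub>1 * \<epsilon>\<^sub>2 t * \<kappa>\<^sup>2) * \<epsilon>\<^sub>2 t - \<epsilon>\<^sub>3 t * \<tau>\<^sup>2) = k\<^sub>2 t * \<phi>\<^sup>2 * \<epsilon>\<^sub>2 t * \<kappa> * \<epsilon>\<^sub>2 t"
    using arg_cong[OF eq, of "\<lambda>x. x \<bullet> (G *v N t c)"]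
    by (simp add: inner_add_left inner_diff_left inner W power2_eq_square algebra_simps)
  \<comment> \<open>The nonzero factor shared by both sides is split off for cancellation, leaving
    one \<open>\<phi>\<^sup>2\<close> on the left.\<close>
  then have "(\<phi>\<^sup>2 * \<epsilon>\<^sub>2 t * \<kappa>) * (\<phi>\<^sup>2 * ((- \<epsilon>\<^sub>1 * \<epsilon>\<^sub>2 t * \<kappa>\<^sup>2) * \<epsilon>\<^sub>2 t - \<epsilon>\<^sub>3 t * \<tau>\<^sup>2))
      = (\<phi>\<^sup>2 * \<epsilon>\<^sub>2 t * \<kappa>) * (k\<^sub>2 t * \<epsilon>\<^sub>2 t)"
    by (simp add: power2_eq_square power4_eq_xxxx mult_ac)
  moreover have "\<phi>\<^sup>2 * \<epsilon>\<^sub>2 t * \<kappa> \<noteq> 0"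
    using phi_pos[OF t] curvature_pos[OF t] eps2_square[OF t] by auto
  ultimately have k2: "\<phi>\<^sup>2 * ((- \<epsilon>\<^sub>1 * \<epsilon>\<^sub>2 t * \<kappa>\<^sup>2) * \<epsilon>\<^sub>2 t - \<epsilon>\<^sub>3 t * \<tau>\<^sup>2) = k\<^sub>2 t * \<epsilon>\<^sub>2 t"
    by (rule mult_left_cancel[THEN iffD1, rotated])
  \<comment> \<open>Multiplication by \<open>\<epsilon>\<^sub>2 t\<close>, which is its own inverse,
    isolates the curvature.\<close>
  have "k\<^sub>2 t = k\<^sub>2 t * \<epsilon>\<^sub>2 t * \<epsilon>\<^sub>2 t"
    using eps2_square[OF t] by (simp add: power2_eq_square)
  also have "\<dots> = \<phi>\<^sup>2 * (- \<epsilon>\<^sub>1 * (\<epsilon>\<^sub>2 t)\<^sup>2 * \<kappa>\<^sup>2 - \<epsilon>\<^sub>3 t * \<tau>\<^sup>2) * \<epsilon>\<^sub>2 t"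
    unfolding k2[symmetric] by (simp add: power2_eq_square algebra_simps)
  also have "\<dots> = - (\<epsilon>\<^sub>2 t * (\<epsilon>\<^sub>1 * \<kappa>\<^sup>2 + \<epsilon>\<^sub>3 t * \<tau>\<^sup>2)) * \<phi>\<^sup>2"
    unfolding eps2_square[OF t] by (simp add: algebra_simps)
  finally show "k\<^sub>2 t = - (\<epsilon>\<^sub>2 t * (\<epsilon>\<^sub>1 * \<kappa>\<^sup>2 + \<epsilon>\<^sub>3 t * \<tau>\<^sup>2)) / (\<kappa> powr (2/3) * \<bar>\<tau>\<bar> powr (1/3))"
    unfolding phi_square[OF t] by simp
qed

end

theorem corollary1:
  fixes A :: "'m::{t2_space,second_countable_topology} chart set"
    and g :: "'m metric"
    and D :: "'m connection"
    and I :: "real set"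
    and \<alpha> :: "real \<Rightarrow> 'm"
    and \<epsilon>\<^sub>1 :: real
    and \<kappa> \<tau> k\<^sub>1 k\<^sub>2 :: "real \<Rightarrow> real"
    and N :: "real \<Rightarrow> 'm tvec"
  assumes "connected (UNIV :: 'm set)"
    and "oriented_atlas A"
    and "pseudo_riemannian_metric A g"
    and "levi_civita A g D"
    and "open I" and "is_interval I" and "I \<noteq> {}"
    and "smooth_curve A I \<alpha>"
    and "arc_length_parametrized A g I \<alpha> \<epsilon>\<^sub>1"
    and "\<forall>t\<in>I. g (\<alpha> t) (accel A D \<alpha> t) (accel A D \<alpha> t) \<noteq> 0"
    and "nondegenerate_curve A g D I \<alpha>"
    and "frenet_curvature A g D I \<alpha> \<kappa> N"
    and "frenet_torsion A g D I \<alpha> \<epsilon>\<^sub>1 \<kappa> N \<tau>"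
    and "equi_affine_curvatures A g D I \<alpha> k\<^sub>1 k\<^sub>2"
    and "\<kappa> constant_on I"
    and "\<tau> constant_on I"
  shows "k\<^sub>1 constant_on I \<and> k\<^sub>2 constant_on I \<and>
    (\<forall>t\<in>I. k\<^sub>1 t = 0 \<and>
       k\<^sub>2 t = - (eps2 A g D \<alpha> t * (\<epsilon>\<^sub>1 * (\<kappa> t)\<^sup>2 + eps3 A g D \<alpha> \<epsilon>\<^sub>1 t * (\<tau> t)\<^sup>2))
                / (\<kappa> t powr (2/3) * \<bar>\<tau> t\<bar> powr (1/3)))"
proof -
  obtain \<kappa>\<^sub>0 \<tau>\<^sub>0 where const: "\<And>t. t \<in> I \<Longrightarrow> \<kappa> t = \<kappa>\<^sub>0" "\<And>t. t \<in> I \<Longrightarrow> \<tau> t = \<tau>\<^sub>0"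
    using assms(15,16) by (auto simp: constant_on_def)
  interpret constant_frenet_curve A g D I \<alpha> \<epsilon>\<^sub>1 \<kappa>\<^sub>0 \<tau>\<^sub>0 N
  proof
    show "frenet_curvature A g D I \<alpha> (\<lambda>_. \<kappa>\<^sub>0) N"
      using assms(12) const(1) by (simp add: frenet_curvature_def)
    show "frenet_torsion A g D I \<alpha> \<epsilon>\<^sub>1 (\<lambda>_. \<kappa>\<^sub>0) N (\<lambda>_. \<tau>\<^sub>0)"
      using assms(13) const by (simp add: frenet_torsion_def)
  qed (use assms in auto)
  note k = equi_affine_curvatures_eq[OF assms(14)]
  \<comment> \<open>The formula for the second curvature still contains signs evaluated at
    \<open>t\<close>; its constancy rests on theirs.\<close>
  obtain e\<^sub>2 e\<^sub>3 where eps: "\<And>t. t \<in> I \<Longrightarrow> \<epsilon>\<^sub>2 t = e\<^sub>2" "\<And>t. t \<in> I \<Longrightarrow> \<epsilon>\<^sub>3 t = e\<^sub>3"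
    using eps2_constant_on eps3_constant_on by (auto simp: constant_on_def)
  have "k\<^sub>1 constant_on I"
    using k(1) by (auto simp: constant_on_def)
  moreover have "k\<^sub>2 constant_on I"
    unfolding constant_on_def using k(2) eps by auto
  ultimately show ?thesis
    using k const by simp
qed

end
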